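(* Let $G$ and $H$ be two connected graphs, where $G$ is non-trivial (has at least two vertices) and non-complete. Let $r\in\{0,1,2,3\}$ with $r\equiv \kappa(G)\pmod 4$. Then $$\kappa_3(G\circ H)\leq \Big\lfloor \tfrac{4}{3}\kappa_3(G)+r-\tfrac{4}{3}\lceil\tfrac{r}{2}\rceil\Big\rfloor |V(H)|.$$ Moreover, the bound is sharp, i.e., there exist such graphs $G,H$ for which equality holds.
   Context: All graphs are finite, simple and undirected. $\kappa(G)$ denotes the (vertex-)connectivity of $G$. For $S\subseteq V(G)$ with $|S|\ge 2$, an $S$-tree is a subgraph of $G$ that is a tree containing $S$; two $S$-trees $T,T'$ are internally disjoint if $E(T)\cap E(T')=\varnothing$ and $V(T)\cap V(T')=S$. $\kappa(S)$ is the maximum number of pairwise internally disjoint $S$-trees in $G$. For $2\le k\le |V(G)|$, $\kappa_k(G)=\min\{\kappa(S): S\subseteq V(G),\ |S|=k\}$; by convention $\kappa_k(G)=1$ if $G$ is connected with fewer than $k$ vertices, and $\kappa_k(G)=0$ if $G$ is disconnected. $G\circ H$ is the lexicographic product: vertex set $V(G)\times V(H)$, with distinct $(u,v),(u',v')$ adjacent iff either $uu'\in E(G)$, or $u=u'$ and $vv'\in E(H)$. *)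

theory Defs
  imports
    "Graph_Theory.Graph_Theory"
    "HOL-Number_Theory.Cong"
begin

text \<open>
  A finite simple undirected graph is a \<^locale>\<open>pair_graph\<close>: a finite, loop-free, symmetric
  digraph without parallel arcs, where the edge \<open>uv\<close> is the pair of arcs \<open>(u,v)\<close>, \<open>(v,u)\<close>.
  The library's notion of connectedness excludes the graph without vertices.

  The library predicates \<^const>\<open>forest\<close> and \<^const>\<open>tree\<close> are about directed cycles and count
  \<open>u, v, u\<close> as a cycle, so that no symmetric digraph with an arc is a forest.  The cycles of the
  underlying undirected graph are the directed cycles of length at least 3.
\<close>

definition undirected_tree :: "'a pair_pre_digraph \<Rightarrow> bool" where
  "undirected_tree T \<longleftrightarrow>
     pair_graph T \<and> Digraph_Component.connected (with_proj T) \<and>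
     \<not> (\<exists>p. pre_digraph.cycle (with_proj T) p \<and> 3 \<le> length p)"

definition S_trees :: "'a pair_pre_digraph \<Rightarrow> 'a set \<Rightarrow> 'a pair_pre_digraph set" where
  "S_trees G S =
     {T. undirected_tree T \<and> subgraph (with_proj T) (with_proj G) \<and> S \<subseteq> pverts T}"

definition internally_disjoint ::
    "'a set \<Rightarrow> 'a pair_pre_digraph \<Rightarrow> 'a pair_pre_digraph \<Rightarrow> bool" where
  "internally_disjoint S T T' \<longleftrightarrow>
     parcs T \<inter> parcs T' = {} \<and> pverts T \<inter> pverts T' = S"

definition tree_connectivity :: "'a pair_pre_digraph \<Rightarrow> 'a set \<Rightarrow> nat" where
  "tree_connectivity G S =
     Max {card F | F. F \<subseteq> S_trees G S \<and> pairwise (internally_disjoint S) F}"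

definition gen_connectivity :: "nat \<Rightarrow> 'a pair_pre_digraph \<Rightarrow> nat" where
  "gen_connectivity k G =
     (if \<not> Digraph_Component.connected (with_proj G) then 0
      else if card (pverts G) < k then 1
      else Min {tree_connectivity G S | S. S \<subseteq> pverts G \<and> card S = k})"

text \<open>
  The least number of vertices whose deletion leaves a disconnected graph or a single vertex;
  in particular a complete graph on \<open>n \<ge> 1\<close> vertices has connectivity \<open>n - 1\<close>.
\<close>

definition vertex_connectivity :: "'a pair_pre_digraph \<Rightarrow> nat" where
  "vertex_connectivity G =
     Min {card X | X. X \<subseteq> pverts G \<and>
       (\<not> Digraph_Component.connected (with_proj G \<restriction> (pverts G - X)) \<or>
        card (pverts G - X) = 1)}"

definition complete_graph :: "'a pair_pre_digraph \<Rightarrow> bool" where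
  "complete_graph G \<longleftrightarrow> complete_digraph (card (pverts G)) (with_proj G)"

definition lex_product ::
    "'a pair_pre_digraph \<Rightarrow> 'b pair_pre_digraph \<Rightarrow> ('a \<times> 'b) pair_pre_digraph" where
  "lex_product G H =
     \<lparr> pverts = pverts G \<times> pverts H,
       parcs = {((u, v), (u', v')) | u v u' v'.
         u \<in> pverts G \<and> u' \<in> pverts G \<and> v \<in> pverts H \<and> v' \<in> pverts H \<and>
         ((u, u') \<in> parcs G \<or> u = u' \<and> (v, v') \<in> parcs H)} \<rparr>"

end

theory Submission
  imports Defs
begin

text \<open>
  If \<open>X\<close> is a minimum vertex cut of \<open>G\<close>, then \<open>X \<times> V(H)\<close> separates two vertices of the product, and every
  tree containing both uses a private vertex of it; hence \<open>\<kappa>\<^sub>3(G \<circ> H) \<le> \<kappa>(G) |V(H)|\<close>.  Writing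
  \<open>\<kappa>(G) = 4q + r\<close>, it remains to see that \<open>\<kappa>\<^sub>3(G) \<ge> 3q + \<lceil>r/2\<rceil> = \<lfloor>(3\<kappa>(G) + 1)/4\<rfloor>\<close>.

  For three terminals \<open>a\<close>, \<open>b\<close>, \<open>c\<close> in a \<open>k\<close>-connected graph, a three-class version of Menger's theorem gives
  internally disjoint connected pieces, each joining two or all three of the terminals, such that every
  terminal lies on exactly \<open>k\<close> of them.  Then the numbers of \<open>ab\<close>-, \<open>bc\<close>- and \<open>ca\<close>-pieces are all equal to
  some \<open>m\<close>, and \<open>k - 2m\<close> pieces join all three.  Two pieces of different types together join all three
  terminals, so the \<open>3m\<close> smaller pieces pair up to \<open>\<lfloor>3m/2\<rfloor>\<close> further trees, which gives
  \<open>k - \<lceil>m/2\<rceil>\<close> trees in total.  Equality in the theorem holds for the path on three vertices and a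
  one-vertex graph \<open>H\<close>.
\<close>

section \<open>Linking three vertex sets\<close>

definition connected_in :: "'v rel \<Rightarrow> 'v set \<Rightarrow> bool" where
  "connected_in E D \<longleftrightarrow> (\<forall>u\<in>D. \<forall>v\<in>D. (u, v) \<in> (E \<inter> D \<times> D)\<^sup>*)"

definition separates :: "'v rel \<Rightarrow> 'v set \<Rightarrow> 'v set \<Rightarrow> 'v set \<Rightarrow> bool" where
  "separates E Y A B \<longleftrightarrow> (\<forall>a\<in>A - Y. \<forall>b\<in>B - Y. (a, b) \<notin> (E \<inter> (- Y) \<times> (- Y))\<^sup>*)"

text \<open>Menger's condition. Separators may use vertices of \<open>A\<close> and
  \<open>B\<close>, and a common vertex of \<open>A\<close> and \<open>B\<close> lies in every
  separator, because the trivial walk counts.\<close>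

definition linked :: "'v rel \<Rightarrow> 'v set \<Rightarrow> 'v set \<Rightarrow> bool" where
  "linked E A B \<longleftrightarrow> (\<forall>Y. finite Y \<longrightarrow> separates E Y A B \<longrightarrow> card A \<le> card Y)"

definition at_most_one :: "'v set \<Rightarrow> bool" where
  "at_most_one X \<longleftrightarrow> (\<forall>u\<in>X. \<forall>v\<in>X. u = v)"

definition link_piece :: "'v rel \<Rightarrow> 'v set \<Rightarrow> 'v set \<Rightarrow> 'v set \<Rightarrow> 'v set \<Rightarrow> bool" where
  "link_piece E A B C D \<longleftrightarrow>
     connected_in E D \<and>
     at_most_one (D \<inter> A) \<and> at_most_one (D \<inter> B) \<and> at_most_one (D \<inter> C) \<and>
     (D \<inter> A \<noteq> {} \<and> D \<inter> B \<noteq> {} \<or> D \<inter> A \<noteq> {} \<and> D \<inter> C \<noteq> {} \<or> D \<inter> B \<noteq> {} \<and> D \<inter> C \<noteq> {})"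

text \<open>Covering, together with the clauses on \<open>at_most_one\<close>, makes the number of
  pieces meeting a finite class equal to the size of that class.\<close>

definition link_system :: "'v rel \<Rightarrow> 'v set \<Rightarrow> 'v set \<Rightarrow> 'v set \<Rightarrow> 'v set set \<Rightarrow> bool" where
  "link_system E A B C \<D> \<longleftrightarrow>
     disjoint \<D> \<and> (\<forall>D\<in>\<D>. link_piece E A B C D) \<and> A \<union> B \<union> C \<subseteq> \<Union>\<D>"

section \<open>Walks and connected vertex sets\<close>

lemma sym_restrict: "sym E \<Longrightarrow> sym (E \<inter> D \<times> D)"
  by (auto simp: sym_def)

lemma rtrancl_restrict_mem:
  "(a, b) \<in> (E \<inter> D \<times> D)\<^sup>* \<Longrightarrow> a \<in> D \<Longrightarrow> b \<in> D"
  by (induction rule: rtrancl_induct) auto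

text \<open>The walk is cut at its first vertex in \<open>X\<close>: until then it stays in
  \<open>I - X\<close>, where every step is a \<open>q\<close>-step inside \<open>I\<close>.\<close>

lemma rtrancl_first_hit:
  assumes "(s, t) \<in> r\<^sup>*" "s \<in> I" "t \<notin> I - X"
    and step: "\<And>u w. u \<in> I - X \<Longrightarrow> (u, w) \<in> r \<Longrightarrow> w \<in> I \<and> (u, w) \<in> q"
  obtains z where "z \<in> X \<inter> I" "(s, z) \<in> q\<^sup>*"
proof -
  have "(\<exists>z\<in>X \<inter> I. (s, z) \<in> q\<^sup>*) \<or> (t \<in> I - X \<and> (s, t) \<in> q\<^sup>*)"
    using assms(1)
  proof (induction rule: rtrancl_induct)
    case base
    then show ?case using assms(2) by auto
  next
    case (step u w)
    then show ?case using assms(4)[of u w] by (meson DiffI IntI rtrancl.rtrancl_into_rtrancl)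
  qed
  with assms(3) that show thesis by blast
qed

lemma connected_in_root:
  assumes "sym E" "\<And>w. w \<in> D \<Longrightarrow> (u, w) \<in> (E \<inter> D \<times> D)\<^sup>*"
  shows "connected_in E D"
  unfolding connected_in_def
proof (intro ballI)
  fix v w assume "v \<in> D" "w \<in> D"
  moreover have "sym ((E \<inter> D \<times> D)\<^sup>*)" using assms(1) by (intro sym_rtrancl sym_restrict)
  ultimately show "(v, w) \<in> (E \<inter> D \<times> D)\<^sup>*"
    using assms(2) by (meson symD rtrancl_trans)
qed

lemma connected_in_mono: "connected_in E D \<Longrightarrow> E \<subseteq> F \<Longrightarrow> connected_in F D"
  unfolding connected_in_def by (meson Int_mono order_refl rtrancl_mono subsetD)

lemma connected_in_subset:
  assumes "connected_in E D" "E \<subseteq> W \<times> W" "D \<inter> W \<noteq> {}"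
  shows "D \<subseteq> W"
proof
  fix v assume "v \<in> D"
  obtain d where d: "d \<in> D" "d \<in> W" using assms(3) by blast
  then have "(d, v) \<in> (E \<inter> D \<times> D)\<^sup>*" using assms(1) \<open>v \<in> D\<close> by (auto simp: connected_in_def)
  then have "(d, v) \<in> (E \<inter> W \<times> W)\<^sup>*"
    using assms(2) by (metis inf.absorb_iff1 inf_le1 rtrancl_mono subsetD)
  then show "v \<in> W" using d(2) by (rule rtrancl_restrict_mem)
qed

lemma connected_in_union:
  assumes "sym E" "connected_in E D" "connected_in E D'"
    and u: "u \<in> D" and v: "v \<in> D'" and uv: "u = v \<or> (u, v) \<in> E"
  shows "connected_in E (D \<union> D')"
proof -
  let ?r = "E \<inter> (D \<union> D') \<times> (D \<union> D')"
  have m: "(E \<inter> D \<times> D)\<^sup>* \<subseteq> ?r\<^sup>*" "(E \<inter> D' \<times> D')\<^sup>* \<subseteq> ?r\<^sup>*"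
    by (rule rtrancl_mono, blast)+
  have e: "(u, v) \<in> ?r\<^sup>*" using uv u v by blast
  have "(u, w) \<in> ?r\<^sup>*" if "w \<in> D \<union> D'" for w
    using that
  proof
    assume "w \<in> D"
    with u assms(2) show ?thesis using m(1) by (auto simp: connected_in_def)
  next
    assume "w \<in> D'"
    with v assms(3) have "(v, w) \<in> ?r\<^sup>*" using m(2) by (auto simp: connected_in_def)
    with e show ?thesis by (rule rtrancl_trans)
  qed
  then show ?thesis using assms(1) by (rule connected_in_root[rotated])
qed

lemma separates_sym:
  assumes "sym E" "separates E Y A B" shows "separates E Y B A"
  using assms(2) sym_rtrancl[OF sym_restrict[OF assms(1), of "- Y"]]
  unfolding separates_def by (meson symD)

text \<open>
  Suppose that deleting the edge \<open>xy\<close> makes \<open>A\<close> separable from \<open>B \<union> C\<close> by a set \<open>Y\<close> smaller than \<open>A\<close>.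
  Let \<open>R\<close> be the part still reachable from \<open>A\<close> off \<open>Y\<close>, with \<open>x\<close> in \<open>R\<close>.  Inside \<open>R \<union> Y\<close> the set
  \<open>A\<close> is linked to \<open>Y \<union> {x}\<close>; outside \<open>R\<close> the set \<open>Y \<union> {y}\<close> can play the role of \<open>A\<close>, because
  walks from \<open>B\<close> or \<open>C\<close> towards \<open>A\<close> may be cut off at their first vertex in \<open>Y \<union> {y}\<close>.  The two systems
  given by induction are glued along \<open>Y\<close> and the edge \<open>xy\<close>.  The case \<open>C = {}\<close> is Menger's theorem.
\<close>

lemma link_system_step:
  fixes E :: "'v rel"
  assumes symE: "sym E"
    and fin: "finite A" "finite B" "finite C"
    and linkA: "linked E A (B \<union> C)" and linkB: "linked E B (A \<union> C)" and linkC: "linked E C (A \<union> B)"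
    and e: "(x0, y0) \<in> E" and E'_def: "E' = E - {(x0, y0), (y0, x0)}"
    and finY: "finite Y" and sepY: "separates E' Y A (B \<union> C)" and cardY: "card Y < card A"
    and IH: "\<And>F A B C. \<lbrakk>F \<subseteq> E'; sym F; finite A; finite B; finite C;
       linked F A (B \<union> C); linked F B (A \<union> C); linked F C (A \<union> B)\<rbrakk> \<Longrightarrow> \<exists>\<D>. link_system F A B C \<D>"
  shows "\<exists>\<D>. link_system E A B C \<D>"
proof -
  define R where "R = {v. \<exists>a\<in>A - Y. (a, v) \<in> (E' \<inter> (- Y) \<times> (- Y))\<^sup>*}"
  have E'E: "E' \<subseteq> E" by (auto simp: E'_def)
  have symE': "sym E'" using symE by (auto simp: E'_def sym_def)
  have R_step: "w \<in> R" if "u \<in> R" "(u, w) \<in> E'" "w \<notin> Y" for u w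
  proof -
    obtain a where a: "a \<in> A - Y" "(a, u) \<in> (E' \<inter> (- Y) \<times> (- Y))\<^sup>*"
      using \<open>u \<in> R\<close> by (auto simp: R_def)
    then have "u \<in> - Y" by (blast dest: rtrancl_restrict_mem)
    with a that have "(a, w) \<in> (E' \<inter> (- Y) \<times> (- Y))\<^sup>*" by (auto intro: rtrancl_into_rtrancl)
    with a show ?thesis by (auto simp: R_def)
  qed
  have RY: "R \<inter> Y = {}" by (auto simp: R_def dest: rtrancl_restrict_mem)
  have AR: "A - Y \<subseteq> R" by (auto simp: R_def)
  have BCR: "(B \<union> C) \<inter> R = {}" using sepY RY by (auto simp: R_def separates_def)
  have "\<not> separates E Y A (B \<union> C)" using linkA finY cardY by (auto simp: linked_def)
  then obtain a b where ab: "a \<in> A - Y" "b \<in> (B \<union> C) - Y" "(a, b) \<in> (E \<inter> (- Y) \<times> (- Y))\<^sup>*"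
    by (auto simp: separates_def)
  \<comment> \<open>\<open>Y\<close> is too small to separate in \<open>E\<close>, so some
    \<open>E\<close>-arc off \<open>Y\<close> leaves \<open>R\<close>. As \<open>R\<close> is closed
    under \<open>E'\<close>-arcs off \<open>Y\<close>, this arc is a deleted one; \<open>x\<close>
    and \<open>y\<close> name its ends in the order of leaving \<open>R\<close>.\<close>
  have "\<exists>u w. u \<in> R \<and> w \<notin> R \<and> (u, w) \<in> E \<inter> (- Y) \<times> (- Y)"
  proof (rule ccontr)
    assume no: "\<not> ?thesis"
    have "v \<in> R" if "(a, v) \<in> (E \<inter> (- Y) \<times> (- Y))\<^sup>*" for v
      using that
    proof (induction rule: rtrancl_induct)
      case base
      then show ?case using AR ab(1) by blast
    next
      case (step u w)
      then show ?case using no by blast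
    qed
    with ab BCR show False by blast
  qed
  then obtain x y where xy: "x \<in> R" "y \<notin> R" "(x, y) \<in> E" "x \<notin> Y" "y \<notin> Y" by blast
  then have "(x, y) \<notin> E'" using R_step by blast
  with xy have E': "E' = E - {(x, y), (y, x)}" by (auto simp: E'_def)
  have R_exit: "w \<in> R \<union> Y \<or> u = x \<and> w = y" if "u \<in> R" "(u, w) \<in> E" for u w
    using R_step[of u w] that xy by (auto simp: E')

  define X1 where "X1 = insert x Y"
  define X2 where "X2 = insert y Y"
  define E1 where "E1 = E' \<inter> (R \<union> Y) \<times> (R \<union> Y)"
  define E2 where "E2 = E' \<inter> (- R) \<times> (- R)"
  \<comment> \<open>A separator with at least \<open>card A\<close> vertices is then large enough
    for \<open>X1\<close> and \<open>X2\<close> too, so their linkage can be derived from that of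
    \<open>A\<close>.\<close>
  have cardX: "card X1 \<le> card A" "card X2 \<le> card A"
    using cardY finY by (auto simp: X1_def X2_def card_insert_if)
  have finX: "finite X1" "finite X2" using finY by (auto simp: X1_def X2_def)
  have sym1: "sym E1" and sym2: "sym E2" using symE' by (auto simp: E1_def E2_def intro: sym_restrict)

  \<comment> \<open>\<open>R\<close> can be left only into \<open>Y\<close> or along
    \<open>xy\<close>, so a walk from \<open>A\<close> to \<open>B \<union> C\<close> meets
    \<open>X1\<close>, and up to its first vertex there it uses only arcs of
    \<open>E1\<close>.\<close>
  have hit1: "\<exists>z\<in>X1 - Z. (s, z) \<in> (E1 \<inter> (- Z) \<times> (- Z))\<^sup>*"
    if "s \<in> A - Z" "t \<in> B \<union> C" and walk: "(s, t) \<in> (E \<inter> (- Z) \<times> (- Z))\<^sup>*" for s t Z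
  proof -
    have "s \<in> R \<union> Y" "t \<notin> (R \<union> Y) - X1" using that AR BCR by (auto simp: X1_def)
    moreover have "w \<in> R \<union> Y \<and> (u, w) \<in> E1 \<inter> (- Z) \<times> (- Z)"
      if "u \<in> (R \<union> Y) - X1" "(u, w) \<in> E \<inter> (- Z) \<times> (- Z)" for u w
      using that R_exit[of u w] xy by (auto simp: E1_def E' X1_def)
    ultimately obtain z where "z \<in> X1" "(s, z) \<in> (E1 \<inter> (- Z) \<times> (- Z))\<^sup>*"
      using rtrancl_first_hit[OF walk, of "R \<union> Y" X1 "E1 \<inter> (- Z) \<times> (- Z)"] by blast
    moreover from this(2) have "z \<in> - Z" using \<open>s \<in> A - Z\<close> by (blast dest: rtrancl_restrict_mem)
    ultimately show ?thesis by blast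
  qed
  \<comment> \<open>The mirror image outside \<open>R\<close>. The target \<open>X\<close> may
    exceed \<open>X2\<close>, so that a walk may also end in the remaining class.\<close>
  have hit2: "\<exists>z\<in>X - Z. (s, z) \<in> (E2 \<inter> (- Z) \<times> (- Z))\<^sup>*"
    if "s \<in> B \<union> C" "s \<notin> Z" "X2 \<subseteq> X" "t \<in> R \<union> X" and walk: "(s, t) \<in> (E \<inter> (- Z) \<times> (- Z))\<^sup>*" for s t X Z
  proof -
    have "s \<in> - R" "t \<notin> - R - X" using that BCR by auto
    moreover have "w \<in> - R \<and> (u, w) \<in> E2 \<inter> (- Z) \<times> (- Z)"
      if "u \<in> - R - X" "(u, w) \<in> E \<inter> (- Z) \<times> (- Z)" for u w
      using that R_exit[of w u] symD[OF symE, of u w] xy \<open>X2 \<subseteq> X\<close> by (auto simp: E2_def E' X2_def)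
    ultimately obtain z where "z \<in> X" "(s, z) \<in> (E2 \<inter> (- Z) \<times> (- Z))\<^sup>*"
      using rtrancl_first_hit[OF walk, of "- R" X "E2 \<inter> (- Z) \<times> (- Z)"] by blast
    moreover from this(2) have "z \<in> - Z" using \<open>s \<notin> Z\<close> by (blast dest: rtrancl_restrict_mem)
    ultimately show ?thesis by blast
  qed
  have AX: "A \<subseteq> R \<union> X2" using AR by (auto simp: X2_def)

  have sep1: "card A \<le> card Z" if "finite Z" "separates E1 Z A X1" for Z
  proof -
    have "separates E Z A (B \<union> C)"
      unfolding separates_def
    proof (intro ballI notI)
      fix s t assume "s \<in> A - Z" "t \<in> (B \<union> C) - Z" "(s, t) \<in> (E \<inter> (- Z) \<times> (- Z))\<^sup>*"
      with hit1[of s Z t] that(2) show False by (auto simp: separates_def)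
    qed
    with linkA that(1) show ?thesis by (auto simp: linked_def)
  qed
  have sep2: "card A \<le> card Z" if "finite Z" "separates E2 Z (B \<union> C) X2" for Z
  proof -
    have "separates E Z (B \<union> C) A"
      unfolding separates_def
    proof (intro ballI notI)
      fix s t assume "s \<in> (B \<union> C) - Z" "t \<in> A - Z" "(s, t) \<in> (E \<inter> (- Z) \<times> (- Z))\<^sup>*"
      with hit2[of s Z X2 t] that(2) AX show False by (auto simp: separates_def)
    qed
    with linkA that(1) separates_sym[OF symE] show ?thesis by (auto simp: linked_def)
  qed
  have sep3: "separates E Z K (A \<union> L)"
    if "separates E2 Z K (X2 \<union> L)" "K \<subseteq> B \<union> C" for Z K L
    unfolding separates_def
  proof (intro ballI notI)
    fix s t assume "s \<in> K - Z" "t \<in> A \<union> L - Z" "(s, t) \<in> (E \<inter> (- Z) \<times> (- Z))\<^sup>*"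
    with hit2[of s Z "X2 \<union> L" t] that AX show False by (auto simp: separates_def)
  qed

  have "\<exists>\<D>. link_system E1 A X1 {} \<D>"
    by (rule IH) (use sym1 fin finX cardX sep1 separates_sym[OF sym1] in
        \<open>auto simp: linked_def E1_def intro: order_trans\<close>)
  then obtain \<D>1 where D1: "link_system E1 A X1 {} \<D>1" by blast
  have "\<exists>\<D>. link_system E2 X2 B C \<D>"
  proof (rule IH)
    show "linked E2 X2 (B \<union> C)"
      unfolding linked_def using sep2 separates_sym[OF sym2] cardX(2) order_trans by blast
    show "linked E2 B (X2 \<union> C)"
      using linkB sep3[of _ B C] by (auto simp: linked_def)
    show "linked E2 C (X2 \<union> B)"
      using linkC sep3[of _ C B] by (auto simp: linked_def)
  qed (use sym2 fin finX in \<open>auto simp: E2_def\<close>)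
  then obtain \<D>2 where D2: "link_system E2 X2 B C \<D>2" by blast

  have p1: "link_piece E1 A X1 {} D" "D \<subseteq> R \<union> Y" "D \<inter> A \<noteq> {}" "D \<inter> X1 \<noteq> {}" if "D \<in> \<D>1" for D
  proof -
    show *: "link_piece E1 A X1 {} D" using D1 that by (auto simp: link_system_def)
    then show **: "D \<inter> A \<noteq> {}" "D \<inter> X1 \<noteq> {}" by (auto simp: link_piece_def)
    show "D \<subseteq> R \<union> Y"
      using * connected_in_subset[of E1 D "R \<union> Y"] ** AR by (fastforce simp: link_piece_def E1_def)
  qed
  have p2: "link_piece E2 X2 B C D" "D \<subseteq> - R" if "D \<in> \<D>2" for D
  proof -
    show *: "link_piece E2 X2 B C D" using D2 that by (auto simp: link_system_def)
    then have "D \<inter> (B \<union> C) \<noteq> {}" by (auto simp: link_piece_def)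
    then have "D \<inter> - R \<noteq> {}" using BCR by blast
    with * show "D \<subseteq> - R" using connected_in_subset[of E2 D "- R"] by (auto simp: link_piece_def E2_def)
  qed
  have uniq1: "u = v" if "D \<in> \<D>1" "u \<in> D" "v \<in> D" "u \<in> X1" "v \<in> X1" for D u v
    using p1(1)[OF that(1)] that by (auto simp: link_piece_def at_most_one_def)
  have uniq2: "u = v" if "D \<in> \<D>2" "u \<in> D" "v \<in> D" "u \<in> X2" "v \<in> X2" for D u v
    using p2(1)[OF that(1)] that by (auto simp: link_piece_def at_most_one_def)
  have disj1: "D = D'" if "D \<in> \<D>1" "D' \<in> \<D>1" "u \<in> D" "u \<in> D'" for D D' u
    using D1 that by (auto simp: link_system_def dest: disjointD)
  have disj2: "D = D'" if "D \<in> \<D>2" "D' \<in> \<D>2" "u \<in> D" "u \<in> D'" for D D' u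
    using D2 that by (auto simp: link_system_def dest: disjointD)

  \<comment> \<open>\<open>\<sigma>\<close> tells where a piece outside \<open>R\<close> is
    continued: at the same vertex of \<open>Y\<close>, or across the edge \<open>xy\<close> when it
    contains \<open>y\<close>.\<close>
  define \<sigma> where "\<sigma> z = (if z = y then x else z)" for z
  have \<sigma>X: "\<sigma> z \<in> X1" if "z \<in> X2" for z using that by (auto simp: \<sigma>_def X1_def X2_def)
  have \<sigma>inj: "z = z'" if "\<sigma> z = \<sigma> z'" "z \<in> X2" "z' \<in> X2" for z z'
    using that xy by (auto simp: \<sigma>_def X2_def split: if_splits)
  have \<sigma>Y: "\<sigma> z = z" if "\<sigma> z \<in> Y" for z using that xy by (auto simp: \<sigma>_def split: if_splits)
  have "\<forall>z\<in>X1. \<exists>D\<in>\<D>1. z \<in> D" using D1 by (auto simp: link_system_def)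
  then obtain p where p: "\<And>z. z \<in> X1 \<Longrightarrow> p z \<in> \<D>1 \<and> z \<in> p z" by metis
  \<comment> \<open>By \<open>uniq2\<close>, at most one piece is attached to each \<open>D\<close>
    in \<open>\<D>2\<close>.\<close>
  define \<mu> where "\<mu> D = D \<union> (\<Union>z\<in>D \<inter> X2. p (\<sigma> z))" for D
  have \<mu>1: "\<mu> D = D \<union> p (\<sigma> z)" if "D \<in> \<D>2" "z \<in> D" "z \<in> X2" for D z
    using uniq2 that unfolding \<mu>_def by blast
  have \<mu>0: "\<mu> D = D" if "D \<inter> X2 = {}" for D using that by (auto simp: \<mu>_def)
  \<comment> \<open>A piece inside \<open>R \<union> Y\<close> can meet the complement of
    \<open>R\<close> only in \<open>Y\<close>, hence in \<open>X1\<close>, where it has a single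
    vertex.\<close>
  have pY: "w = \<sigma> z \<and> w = z" if "z \<in> X2" "w \<in> p (\<sigma> z)" "w \<notin> R" for z w
  proof -
    have "w \<in> Y" using that p1(2) p \<sigma>X by blast
    then have "w = \<sigma> z" using uniq1[of "p (\<sigma> z)" w "\<sigma> z"] that p \<sigma>X by (auto simp: X1_def)
    then show ?thesis using \<open>w \<in> Y\<close> \<sigma>Y by auto
  qed

  have piece: "link_piece E A B C (\<mu> D)" if D: "D \<in> \<D>2" for D
  proof (cases "D \<inter> X2 = {}")
    case True
    have "D \<inter> A = {}" using p2(2)[OF D] AX True by blast
    moreover have "connected_in E D"
      using p2(1)[OF D] E'E by (auto simp: link_piece_def E2_def intro: connected_in_mono)
    ultimately show ?thesis using p2(1)[OF D] True by (auto simp: \<mu>0 link_piece_def at_most_one_def)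
  next
    case False
    then obtain z where z: "z \<in> D" "z \<in> X2" by blast
    note \<mu> = \<mu>1[OF D z]
    have P: "p (\<sigma> z) \<in> \<D>1" "\<sigma> z \<in> p (\<sigma> z)" using p \<sigma>X z by auto
    have "connected_in E D" "connected_in E (p (\<sigma> z))"
      using p2(1)[OF D] p1(1)[OF P(1)] E'E
      by (auto simp: link_piece_def E2_def E1_def intro: connected_in_mono)
    moreover have "z = \<sigma> z \<or> (z, \<sigma> z) \<in> E" using xy symE by (auto simp: \<sigma>_def dest: symD)
    ultimately have conn: "connected_in E (\<mu> D)" using connected_in_union[OF symE] z P(2) \<mu> by auto
    \<comment> \<open>A vertex of \<open>A\<close> in \<open>D\<close> lies in \<open>Y\<close>, so
      it is the gluing vertex \<open>z\<close> itself, which belongs to the attached piece: gluing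
      creates no second vertex of \<open>A\<close>.\<close>
    have "u \<in> p (\<sigma> z)" if "u \<in> D" "u \<in> A" for u
    proof -
      have "u \<in> X2" "u \<in> Y" using that p2(2)[OF D] AR by (auto simp: X2_def)
      then have "u = z" using uniq2[OF D] that z by blast
      with \<open>u \<in> Y\<close> xy P show ?thesis by (auto simp: \<sigma>_def split: if_splits)
    qed
    then have A: "\<mu> D \<inter> A = p (\<sigma> z) \<inter> A" using \<mu> by blast
    have "u \<in> D" if "u \<in> p (\<sigma> z)" "u \<in> B \<union> C" for u
    proof -
      have "u \<notin> R" using that(2) BCR by blast
      with pY[OF z(2) that(1)] z(1) show ?thesis by metis
    qed
    then have BC: "\<mu> D \<inter> B = D \<inter> B" "\<mu> D \<inter> C = D \<inter> C" using \<mu> by auto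
    show ?thesis
      unfolding link_piece_def A BC
      using conn p1(1)[OF P(1)] p1(3)[OF P(1)] p2(1)[OF D] by (auto simp: link_piece_def)
  qed
  have disj: "D = D'" if D: "D \<in> \<D>2" "D' \<in> \<D>2" and w: "w \<in> \<mu> D" "w \<in> \<mu> D'" for D D' w
  proof -
    have mixed: "D = D'" if "D \<in> \<D>2" "D' \<in> \<D>2" "w \<in> D" "z \<in> D'" "z \<in> X2" "w \<in> p (\<sigma> z)" for D D' z
    proof -
      have "w = z" using pY[OF that(5,6)] p2(2)[OF that(1)] that(3) by blast
      then show ?thesis using disj2[OF that(1,2,3)] that(4) by blast
    qed
    have both: "D = D'" if "z \<in> D" "z \<in> X2" "w \<in> p (\<sigma> z)" "z' \<in> D'" "z' \<in> X2" "w \<in> p (\<sigma> z')" for z z'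
    proof -
      have P: "p (\<sigma> z) \<in> \<D>1" "\<sigma> z \<in> p (\<sigma> z)" "p (\<sigma> z') \<in> \<D>1" "\<sigma> z' \<in> p (\<sigma> z')"
        using p \<sigma>X that by auto
      have "p (\<sigma> z) = p (\<sigma> z')" by (rule disj1[OF P(1,3) that(3,6)])
      then have "\<sigma> z = \<sigma> z'" using uniq1[OF P(1,2)] P \<sigma>X that by auto
      then have "z = z'" using \<sigma>inj that by blast
      then show ?thesis using disj2[OF D that(1)] that(4) by blast
    qed
    from w consider "w \<in> D" "w \<in> D'"
      | z where "w \<in> D" "z \<in> D'" "z \<in> X2" "w \<in> p (\<sigma> z)"
      | z where "w \<in> D'" "z \<in> D" "z \<in> X2" "w \<in> p (\<sigma> z)"
      | z z' where "z \<in> D" "z \<in> X2" "w \<in> p (\<sigma> z)" "z' \<in> D'" "z' \<in> X2" "w \<in> p (\<sigma> z')"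
      unfolding \<mu>_def by blast
    then show ?thesis
    proof cases
      case 1
      then show ?thesis by (rule disj2[OF D])
    next
      case 2
      then show ?thesis by (rule mixed[OF D])
    next
      case 3
      then show ?thesis by (rule mixed[OF D(2,1), symmetric])
    next
      case 4
      then show ?thesis by (rule both)
    qed
  qed
  have "A \<subseteq> \<Union>(\<mu> ` \<D>2)"
  proof
    fix a assume "a \<in> A"
    then obtain Q where Q: "Q \<in> \<D>1" "a \<in> Q" using D1 by (auto simp: link_system_def)
    \<comment> \<open>Every piece of \<open>\<D>1\<close> reaches \<open>X1\<close>, so it gets
      attached to the piece of \<open>\<D>2\<close> through the corresponding vertex of
      \<open>X2\<close>.\<close>
    then obtain u where u: "u \<in> Q" "u \<in> X1" using p1(4) by blast
    have "(if u = x then y else u) \<in> X2" "\<sigma> (if u = x then y else u) = u"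
      using u(2) xy by (auto simp: X1_def X2_def \<sigma>_def)
    then obtain z where z: "z \<in> X2" "\<sigma> z = u" by blast
    then obtain D where D: "D \<in> \<D>2" "z \<in> D" using D2 by (auto simp: link_system_def)
    have "p u = Q" using disj1[of "p u" Q u] Q u p by auto
    then have "a \<in> \<mu> D" using \<mu>1[OF D z(1)] z(2) Q by auto
    with D show "a \<in> \<Union>(\<mu> ` \<D>2)" by blast
  qed
  moreover have "B \<union> C \<subseteq> \<Union>(\<mu> ` \<D>2)" using D2 by (auto simp: link_system_def \<mu>_def)
  moreover have "disjoint (\<mu> ` \<D>2)" 
  proof (rule disjointI)
    fix P Q assume "P \<in> \<mu> ` \<D>2" "Q \<in> \<mu> ` \<D>2" "P \<noteq> Q"
    then show "P \<inter> Q = {}" using disj by blast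
  qed
  ultimately have "link_system E A B C (\<mu> ` \<D>2)" using piece by (auto simp: link_system_def)
  then show ?thesis by blast
qed

text \<open>Induction on the number of arcs. If all three linkages survive the deletion of an edge,
  the smaller system serves for \<open>E\<close> as well. Otherwise a class whose linkage breaks
  plays the role of \<open>A\<close> in \<open>link_system_step\<close>, systems being symmetric in
  the three classes.\<close>

theorem link_system_exists:
  assumes "finite E" "sym E" "finite A" "finite B" "finite C"
    and "linked E A (B \<union> C)" "linked E B (A \<union> C)" "linked E C (A \<union> B)"
  shows "\<exists>\<D>. link_system E A B C \<D>"
  using assms
proof (induction "card E" arbitrary: E A B C rule: less_induct)
  case less
  show ?case
  proof (cases "E = {}")
    case True
    \<comment> \<open>Without arcs \<open>K \<inter> L\<close> separates \<open>K\<close> from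
      \<open>L\<close>, so linkage forces \<open>K \<subseteq> L\<close>. Hence each vertex lies in
      at least two classes and is a piece by itself.\<close>
    have sub: "K \<subseteq> L" if "linked E K L" "finite K" for K L
    proof -
      have "separates E (K \<inter> L) K L" using True by (auto simp: separates_def)
      then have "card K \<le> card (K \<inter> L)" using that by (auto simp: linked_def)
      then show ?thesis using that(2) by (metis card_seteq inf.orderI inf_le1)
    qed
    have "link_system E A B C ((\<lambda>v. {v}) ` (A \<union> B \<union> C))"
      using sub[OF less.prems(6)] sub[OF less.prems(7)] sub[OF less.prems(8)] less.prems
      by (auto simp: link_system_def link_piece_def at_most_one_def connected_in_def disjoint_def)
    then show ?thesis by blast
  next
    case False
    then obtain x y where xy: "(x, y) \<in> E" by auto
    define E' where "E' = E - {(x, y), (y, x)}"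
    have E': "E' \<subset> E" "sym E'" "finite E'" using xy less.prems(1,2) by (auto simp: E'_def sym_def)
    have IH: "\<exists>\<D>. link_system F A B C \<D>"
      if "F \<subseteq> E'" "sym F" "finite A" "finite B" "finite C"
        "linked F A (B \<union> C)" "linked F B (A \<union> C)" "linked F C (A \<union> B)" for F A B C
    proof (rule less.hyps)
      show "card F < card E" using that(1) E' less.prems(1) by (meson order_le_less_trans psubset_card_mono)
      show "finite F" using that(1) E'(3) by (rule finite_subset)
    qed (use that in auto)
    have step: "\<exists>\<D>. link_system E A B C \<D>"
      if prems: "finite A" "finite B" "finite C"
        "linked E A (B \<union> C)" "linked E B (A \<union> C)" "linked E C (A \<union> B)"
        and nl: "\<not> linked E' A (B \<union> C)" for A B C
    proof -
      obtain Y where Y: "finite Y" "separates E' Y A (B \<union> C)" "card Y < card A"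
        using nl by (auto simp: linked_def not_le)
      show ?thesis
        by (rule link_system_step[OF less.prems(2) prems xy E'_def Y]) (rule IH)
    qed
    consider "linked E' A (B \<union> C)" "linked E' B (A \<union> C)" "linked E' C (A \<union> B)"
      | "\<not> linked E' A (B \<union> C)" | "\<not> linked E' B (A \<union> C)" | "\<not> linked E' C (A \<union> B)" by blast
    then show ?thesis
    proof cases
      case 1
      then obtain \<D> where "link_system E' A B C \<D>" using IH[of E' A B C] E' less.prems by auto
      then have "link_system E A B C \<D>"
        using E'(1) by (auto simp: link_system_def link_piece_def intro: connected_in_mono)
      then show ?thesis by blast
    next
      case 2
      then show ?thesis using step less.prems by blast
    next
      case 3
      then obtain \<D> where "link_system E B A C \<D>"
        using step[of B A C] less.prems by (auto simp: Un_commute)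
      then have "link_system E A B C \<D>" unfolding link_system_def link_piece_def by blast
      then show ?thesis by blast
    next
      case 4
      then obtain \<D> where "link_system E C A B \<D>"
        using step[of C A B] less.prems by (auto simp: Un_commute)
      then have "link_system E A B C \<D>" unfolding link_system_def link_piece_def by blast
      then show ?thesis by blast
    qed
  qed
qed

section \<open>Trees in pair graphs\<close>

lemma pair_graphD:
  assumes "pair_graph G"
  shows "finite (pverts G)" "finite (parcs G)" "parcs G \<subseteq> pverts G \<times> pverts G" "sym (parcs G)"
    and "(u, u) \<notin> parcs G"
proof -
  interpret pair_graph G by fact
  show "finite (pverts G)" "finite (parcs G)" by (rule pair_finite_verts pair_finite_arcs)+
  show "parcs G \<subseteq> pverts G \<times> pverts G" by (auto dest: wellformed')
  show "sym (parcs G)" by (auto intro: symI arcs_symmetric)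
  show "(u, u) \<notin> parcs G" using no_loops' by blast
qed

lemma pair_graphI:
  assumes "finite V" "E \<subseteq> V \<times> V" "sym E" "\<And>u. (u, u) \<notin> E"
  shows "pair_graph \<lparr>pverts = V, parcs = E\<rparr>"
proof
  show "finite (parcs \<lparr>pverts = V, parcs = E\<rparr>)"
    using assms(1,2) by (auto intro: finite_subset)
  show "symmetric (with_proj \<lparr>pverts = V, parcs = E\<rparr>)"
    using assms(3) by (simp add: symmetric_def)
qed (use assms in auto)

lemma connected_iff_rtrancl:
  assumes "sym (arcs_ends D)" "arcs_ends D \<subseteq> verts D \<times> verts D"
  shows "Digraph_Component.connected D \<longleftrightarrow> verts D \<noteq> {} \<and> connected_in (arcs_ends D) (verts D)"
proof -
  have "(arcs_ends D)\<^sup>s = arcs_ends D" using assms(1) by (auto simp: symcl_def sym_def)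
  moreover have "(u, v) \<in> rtrancl_on (verts D) (arcs_ends D) \<longleftrightarrow> (u, v) \<in> (arcs_ends D)\<^sup>*"
    if "u \<in> verts D" for u v
  proof
    assume "(u, v) \<in> (arcs_ends D)\<^sup>*"
    then show "(u, v) \<in> rtrancl_on (verts D) (arcs_ends D)"
      using that assms(2) by (induction rule: rtrancl_induct) (auto intro: rtrancl_on_into_rtrancl_on)
  qed (rule rtrancl_on_rtranclI)
  moreover have "arcs_ends D \<inter> verts D \<times> verts D = arcs_ends D" using assms(2) by blast
  ultimately show ?thesis by (simp add: connected_conv connected_in_def)
qed

lemma connected_pair_graph_iff:
  assumes "pair_graph G"
  shows "Digraph_Component.connected (with_proj G) \<longleftrightarrow>
    pverts G \<noteq> {} \<and> connected_in (parcs G) (pverts G)"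
  using connected_iff_rtrancl[of "with_proj G"] pair_graphD[OF assms] by simp

lemma connected_induce_iff:
  assumes "pair_graph G"
  shows "Digraph_Component.connected (with_proj G \<restriction> W) \<longleftrightarrow> W \<noteq> {} \<and> connected_in (parcs G) W"
proof -
  have "arcs_ends (with_proj G \<restriction> W) = parcs G \<inter> W \<times> W"
    by (auto simp: arcs_ends_conv image_iff)
  moreover have "connected_in (parcs G \<inter> W \<times> W) W \<longleftrightarrow> connected_in (parcs G) W"
    by (simp add: connected_in_def)
  ultimately show ?thesis
    using connected_iff_rtrancl[of "with_proj G \<restriction> W"] sym_restrict[OF pair_graphD(4)[OF assms]] by simp
qed

section \<open>Cycles, leaves and spanning trees\<close>

lemma pcas_arcs:
  assumes "pcas u p v"
  shows "tl (pawalk_verts u p) = map snd p"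
    and "Suc i < length p \<Longrightarrow> snd (p ! i) = fst (p ! Suc i)"
    and "p \<noteq> [] \<Longrightarrow> fst (p ! 0) = u \<and> snd (last p) = v"
  using assms
proof (induction p arbitrary: u i)
  case (Cons e p)
  {
    case 1
    then show ?case using Cons.IH(1)[of "snd e"] by (cases p) auto
  next
    case 2
    then show ?case using Cons.IH(2)[of "i - 1" "snd e"] Cons.IH(3)[of "snd e"] by (cases i) auto
  next
    case 3
    then show ?case using Cons.IH(3)[of "snd e"] by auto
  }
qed auto

text \<open>A cycle becomes a cyclic sequence of arcs with distinct heads; the index modulo the
  length includes the passage from the last arc to the first.\<close>

lemma cycle_arcs:
  assumes "pre_digraph.cycle (with_proj T) p"
  shows "set p \<subseteq> parcs T" and "distinct (map snd p)" and "p \<noteq> []"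
    and "i < length p \<Longrightarrow> snd (p ! i) = fst (p ! ((i + 1) mod length p))"
proof -
  obtain u where u: "set p \<subseteq> parcs T" "pcas u p u" "distinct (tl (pawalk_verts u p))" "p \<noteq> []"
    using assms
    by (auto simp: pre_digraph.cycle_def pre_digraph.awalk_def cas_with_proj_eq awalk_verts_with_proj_eq)
  then show "set p \<subseteq> parcs T" "distinct (map snd p)" "p \<noteq> []" using pcas_arcs(1) by metis+
  show "snd (p ! i) = fst (p ! ((i + 1) mod length p))" if "i < length p"
  proof (cases "Suc i < length p")
    case True
    then show ?thesis using pcas_arcs(2)[OF u(2)] by simp
  next
    case False
    then have "Suc i = length p" using that by simp
    then have "p ! i = last p" by (metis diff_Suc_1 last_conv_nth u(4))
    then show ?thesis using pcas_arcs(3)[OF u(2,4)] \<open>Suc i = length p\<close> by simp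
  qed
qed

text \<open>The arc before the one entering \<open>w\<close> ends in \<open>u\<close>, and the arc
  after it returns to \<open>u\<close>. At length at least 3 these are different positions with the
  same head.\<close>

lemma cycle_avoids_leaf:
  assumes p: "pre_digraph.cycle (with_proj T) p" "3 \<le> length p"
    and leaf: "\<And>z. (w, z) \<in> parcs T \<Longrightarrow> z = u" "\<And>z. (z, w) \<in> parcs T \<Longrightarrow> z = u"
    and "i < length p"
  shows "snd (p ! i) \<noteq> w"
proof
  assume i: "snd (p ! i) = w"
  let ?n = "length p"
  define j where "j = (i + 1) mod ?n"
  \<comment> \<open>The cyclic predecessor of \<open>i\<close>; adding \<open>?n\<close> first keeps
    the subtraction from truncating at \<open>i = 0\<close>.\<close>
  define k where "k = (i + ?n - 1) mod ?n"
  have jk: "j < ?n" "k < ?n" "j \<noteq> k" "(k + 1) mod ?n = i"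
  proof -
    show "j < ?n" "k < ?n" using assms(5) unfolding j_def k_def by (intro mod_less_divisor; linarith)+
    have k: "k = (if i = 0 then ?n - 1 else i - 1)"
    proof (cases i)
      case (Suc m)
      then have "i + ?n - 1 = m + ?n" by simp
      then show ?thesis using Suc assms(5) by (simp add: k_def)
    qed (use p(2) in \<open>simp add: k_def\<close>)
    moreover have "j = (if i + 1 = ?n then 0 else i + 1)" using assms(5) by (auto simp: j_def)
    ultimately show "j \<noteq> k" using p(2) by auto
    show "(k + 1) mod ?n = i" using k assms(5) by auto
  qed
  have arcs: "p ! m \<in> parcs T" if "m < ?n" for m using cycle_arcs(1)[OF p(1)] that by force
  have "fst (p ! i) = u" using leaf(2)[of "fst (p ! i)"] arcs[OF assms(5)] i by (metis prod.collapse)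
  then have "snd (p ! k) = u" using cycle_arcs(4)[OF p(1) jk(2)] jk(4) by simp
  moreover have "fst (p ! j) = w" using cycle_arcs(4)[OF p(1) assms(5)] i by (simp add: j_def)
  then have "snd (p ! j) = u" using leaf(1)[of "snd (p ! j)"] arcs[OF jk(1)] by (metis prod.collapse)
  ultimately show False
    using cycle_arcs(2)[OF p(1)] jk by (auto simp: distinct_conv_nth)
qed

text \<open>A cycle of length at least 3 avoids the leaf as a head, and therefore as a tail, since
  each tail is the head of the cyclically preceding arc. It would already be a cycle of the old
  tree.\<close>

lemma undirected_tree_add_leaf:
  assumes T: "undirected_tree \<lparr>pverts = W, parcs = F\<rparr>" and u: "u \<in> W" and w: "w \<notin> W"
  shows "undirected_tree \<lparr>pverts = insert w W, parcs = F \<union> {(u, w), (w, u)}\<rparr>"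
proof -
  let ?T = "\<lparr>pverts = W, parcs = F\<rparr>" and ?T' = "\<lparr>pverts = insert w W, parcs = F \<union> {(u, w), (w, u)}\<rparr>"
  have pg: "pair_graph ?T" using T by (simp add: undirected_tree_def)
  note F = pair_graphD[OF pg, simplified]
  have pg': "pair_graph ?T'"
    by (rule pair_graphI) (use F u w in \<open>auto simp: sym_def\<close>)
  have "connected_in F W" using T connected_pair_graph_iff[OF pg] by (simp add: undirected_tree_def)
  then have "connected_in (parcs ?T') W" by (rule connected_in_mono) auto
  then have "connected_in (parcs ?T') (W \<union> {w})"
    using pair_graphD(4)[OF pg'] u by (intro connected_in_union[of _ _ _ u w]) (auto simp: connected_in_def)
  then have conn: "Digraph_Component.connected (with_proj ?T')"
    using connected_pair_graph_iff[OF pg'] by simp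
  have False if p: "pre_digraph.cycle (with_proj ?T') p" "3 \<le> length p" for p
  proof -
    have nw: "snd (p ! i) \<noteq> w" if "i < length p" for i
      by (rule cycle_avoids_leaf[OF p]) (use F w that in auto)
    have "p ! i \<in> F" if "i < length p" for i
    proof -
      have "fst (p ! i) \<noteq> w"
      proof (cases i)
        case 0
        have "snd (p ! (length p - 1)) = fst (p ! ((length p - 1 + 1) mod length p))"
          using cycle_arcs(4)[OF p(1), of "length p - 1"] p(2) by linarith
        moreover have "(length p - 1 + 1) mod length p = 0"
          using p(2) by (metis One_nat_def Suc_pred add.commute length_greater_0_conv mod_self cycle_arcs(3)[OF p(1)] plus_1_eq_Suc)
        ultimately show ?thesis using nw[of "length p - 1"] cycle_arcs(3)[OF p(1)] 0 by simp
      next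
        case (Suc m)
        then show ?thesis using cycle_arcs(4)[OF p(1), of m] nw[of m] that by simp
      qed
      moreover have "p ! i \<in> F \<union> {(u, w), (w, u)}" using cycle_arcs(1)[OF p(1)] that by force
      ultimately show ?thesis using nw[OF that] by auto
    qed
    then have "set p \<subseteq> F" by (metis in_set_conv_nth subsetI)
    then have "pre_digraph.cycle (with_proj ?T) p"
      using p F(3) u
      by (fastforce simp: pre_digraph.cycle_def pre_digraph.awalk_def cas_with_proj_eq
          awalk_verts_with_proj_eq neq_Nil_conv)
    then show False using T p(2) by (auto simp: undirected_tree_def)
  qed
  with pg' conn show ?thesis by (auto simp: undirected_tree_def)
qed

text \<open>A tree is grown from a root by adding one leaf at a time; the induction is on the number
  of missing vertices.\<close>

lemma spanning_tree_exists:
  assumes V: "finite V" "V \<noteq> {}" and E: "E \<subseteq> V \<times> V" "sym E" and conn: "connected_in E V"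
  shows "\<exists>F\<subseteq>E. undirected_tree \<lparr>pverts = V, parcs = F\<rparr>"
proof -
  obtain r where r: "r \<in> V" using V(2) by blast
  have "\<exists>F\<subseteq>E. undirected_tree \<lparr>pverts = V, parcs = F\<rparr>"
    if "F \<subseteq> E" "r \<in> W" "W \<subseteq> V" "undirected_tree \<lparr>pverts = W, parcs = F\<rparr>" for W F
    using that
  proof (induction "card (V - W)" arbitrary: W F rule: less_induct)
    case less
    show ?case
    proof (cases "W = V")
      case True
      then show ?thesis using less.prems by auto
    next
      case False
      then obtain v where v: "v \<in> V" "v \<notin> W" using less.prems by blast
      have "\<exists>u w. u \<in> W \<and> w \<notin> W \<and> (u, w) \<in> E"
      proof (rule ccontr)
        assume no: "\<not> ?thesis"
        have "(r, v) \<in> (E \<inter> V \<times> V)\<^sup>*" using conn r v by (auto simp: connected_in_def)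
        then have "v \<in> W"
          by (induction rule: rtrancl_induct) (use no less.prems(2) in auto)
        with v show False by blast
      qed
      then obtain u w where uw: "u \<in> W" "w \<notin> W" "(u, w) \<in> E" by blast
      show ?thesis
      proof (rule less.hyps)
        show "undirected_tree \<lparr>pverts = insert w W, parcs = F \<union> {(u, w), (w, u)}\<rparr>"
          by (rule undirected_tree_add_leaf[OF less.prems(4) uw(1,2)])
        have "V - insert w W \<subset> V - W" using uw E(1) by blast
        then show "card (V - insert w W) < card (V - W)" using V(1) by (simp add: psubset_card_mono)
        show "F \<union> {(u, w), (w, u)} \<subseteq> E" using less.prems(1) uw(3) E(2) by (auto dest: symD)
      qed (use less.prems uw E(1) in auto)
    qed
  qed
  moreover have "undirected_tree \<lparr>pverts = {r}, parcs = {}\<rparr>"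
  proof -
    have pg: "pair_graph \<lparr>pverts = {r}, parcs = {}\<rparr>" by (rule pair_graphI) (auto simp: sym_def)
    then show ?thesis
      using connected_pair_graph_iff[OF pg] cycle_arcs[of "\<lparr>pverts = {r}, parcs = {}\<rparr>"]
      by (force simp: undirected_tree_def connected_in_def)
  qed
  ultimately show ?thesis using r by blast
qed

section \<open>Tree connectivity and cuts\<close>

lemma finite_S_trees:
  assumes "pair_graph G" shows "finite (S_trees G S)"
proof (rule finite_subset)
  show "S_trees G S \<subseteq> (\<lambda>(V, E). \<lparr>pverts = V, parcs = E\<rparr>) ` (Pow (pverts G) \<times> Pow (parcs G))"
  proof
    fix T assume "T \<in> S_trees G S"
    then have "pverts T \<subseteq> pverts G" "parcs T \<subseteq> parcs G" by (auto simp: S_trees_def subgraph_def)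
    moreover have "T = \<lparr>pverts = pverts T, parcs = parcs T\<rparr>" by simp
    ultimately show "T \<in> (\<lambda>(V, E). \<lparr>pverts = V, parcs = E\<rparr>) ` (Pow (pverts G) \<times> Pow (parcs G))"
      by (intro image_eqI[of _ _ "(pverts T, parcs T)"]) auto
  qed
qed (use pair_graphD[OF assms] in auto)

lemma finite_tree_counts:
  assumes "pair_graph G"
  shows "finite {card F | F. F \<subseteq> S_trees G S \<and> pairwise (internally_disjoint S) F}"
proof (rule finite_subset)
  show "{card F | F. F \<subseteq> S_trees G S \<and> pairwise (internally_disjoint S) F} \<subseteq> card ` Pow (S_trees G S)"
    by auto
qed (use finite_S_trees[OF assms] in simp)

lemma tree_connectivity_ge:
  assumes "pair_graph G" "F \<subseteq> S_trees G S" "pairwise (internally_disjoint S) F"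
  shows "card F \<le> tree_connectivity G S"
  unfolding tree_connectivity_def
  by (rule Max_ge[OF finite_tree_counts[OF assms(1)]]) (use assms in auto)

lemma tree_connectivity_le:
  assumes "pair_graph G"
    and "\<And>F. F \<subseteq> S_trees G S \<Longrightarrow> pairwise (internally_disjoint S) F \<Longrightarrow> card F \<le> m"
  shows "tree_connectivity G S \<le> m"
proof -
  let ?K = "{card F | F. F \<subseteq> S_trees G S \<and> pairwise (internally_disjoint S) F}"
  \<comment> \<open>The empty family keeps the set of sizes nonempty, so that the maximum is
    attained.\<close>
  have "card {} \<in> ?K" by (rule CollectI, rule exI[of _ "{}"]) simp
  then have "Max ?K \<in> ?K" by (intro Max_in finite_tree_counts[OF assms(1)]) auto
  then obtain F where "Max ?K = card F" "F \<subseteq> S_trees G S" "pairwise (internally_disjoint S) F" by auto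
  then show ?thesis using assms(2) by (simp add: tree_connectivity_def)
qed

lemma finite_tree_connectivities:
  assumes "pair_graph G"
  shows "finite {tree_connectivity G S | S. S \<subseteq> pverts G \<and> card S = k}"
proof (rule finite_subset)
  show "{tree_connectivity G S | S. S \<subseteq> pverts G \<and> card S = k} \<subseteq> tree_connectivity G ` Pow (pverts G)"
    by auto
qed (use pair_graphD[OF assms] in simp)

lemma gen_connectivity_le:
  assumes "pair_graph G" "S \<subseteq> pverts G" "card S = k"
  shows "gen_connectivity k G \<le> tree_connectivity G S"
proof -
  have "\<not> card (pverts G) < k" using assms card_mono[OF pair_graphD(1)[OF assms(1)] assms(2)] by simp
  moreover have "Min {tree_connectivity G S | S. S \<subseteq> pverts G \<and> card S = k} \<le> tree_connectivity G S"
    using assms by (intro Min_le finite_tree_connectivities) auto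
  ultimately show ?thesis by (simp add: gen_connectivity_def)
qed

lemma gen_connectivity_ge:
  assumes "pair_graph G" "Digraph_Component.connected (with_proj G)" "k \<le> card (pverts G)"
    and "\<And>S. S \<subseteq> pverts G \<Longrightarrow> card S = k \<Longrightarrow> m \<le> tree_connectivity G S"
  shows "m \<le> gen_connectivity k G"
proof -
  obtain S where "S \<subseteq> pverts G" "card S = k" using obtain_subset_with_card_n[OF assms(3)] by metis
  then have "{tree_connectivity G S | S. S \<subseteq> pverts G \<and> card S = k} \<noteq> {}" by blast
  then have "m \<le> Min {tree_connectivity G S | S. S \<subseteq> pverts G \<and> card S = k}"
    using assms finite_tree_connectivities[OF assms(1)] by (subst Min_ge_iff) auto
  then show ?thesis using assms(2,3) by (simp add: gen_connectivity_def)
qed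

lemma S_tree_connected:
  assumes "T \<in> S_trees G S" "u \<in> S" "v \<in> S"
  shows "(u, v) \<in> (parcs T \<inter> pverts T \<times> pverts T)\<^sup>*"
  using assms connected_pair_graph_iff[of T]
  by (auto simp: S_trees_def undirected_tree_def connected_in_def)

text \<open>Every tree contains a walk from \<open>u\<close> to \<open>v\<close> and hence a vertex
  of \<open>Y\<close>. As \<open>Y\<close> avoids \<open>S\<close>, internally disjoint trees have
  different such vertices.\<close>

lemma tree_connectivity_le_cut:
  assumes G: "pair_graph G" and uv: "u \<in> S" "v \<in> S" and Y: "finite Y" "Y \<inter> S = {}"
    and sep: "separates (parcs G) Y {u} {v}"
  shows "tree_connectivity G S \<le> card Y"
proof (rule tree_connectivity_le[OF G])
  fix F assume F: "F \<subseteq> S_trees G S" "pairwise (internally_disjoint S) F"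
  have "\<exists>y. y \<in> pverts T \<inter> Y" if "T \<in> F" for T
  proof (rule ccontr)
    assume no: "\<nexists>y. y \<in> pverts T \<inter> Y"
    have T: "T \<in> S_trees G S" using that F by blast
    then have "parcs T \<subseteq> parcs G" by (auto simp: S_trees_def subgraph_def)
    then have "parcs T \<inter> pverts T \<times> pverts T \<subseteq> parcs G \<inter> (- Y) \<times> (- Y)" using no by blast
    then have "(u, v) \<in> (parcs G \<inter> (- Y) \<times> (- Y))\<^sup>*"
      using S_tree_connected[OF T uv] rtrancl_mono by blast
    then show False using sep uv Y(2) by (auto simp: separates_def)
  qed
  then obtain f where f: "\<And>T. T \<in> F \<Longrightarrow> f T \<in> pverts T \<inter> Y" by metis
  have "inj_on f F"
  proof (rule inj_onI, rule ccontr)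
    fix T T' assume T: "T \<in> F" "T' \<in> F" "f T = f T'" "T \<noteq> T'"
    then have "f T \<in> pverts T \<inter> pverts T'" using f by (metis IntD1 IntI)
    moreover have "pverts T \<inter> pverts T' = S"
      using F(2) T by (auto simp: pairwise_def internally_disjoint_def)
    ultimately show False using f[OF T(1)] Y(2) by blast
  qed
  then show "card F \<le> card Y" using f Y(1) by (intro card_inj_on_le[of f]) auto
qed

text \<open>Every tree leaves \<open>u\<close> by an arc, and arc-disjoint trees do so by different
  arcs.\<close>

lemma tree_connectivity_le_degree:
  assumes G: "pair_graph G" and uv: "u \<in> S" "v \<in> S" "u \<noteq> v"
  shows "tree_connectivity G S \<le> card {w. (u, w) \<in> parcs G}"
proof (rule tree_connectivity_le[OF G])
  fix F assume F: "F \<subseteq> S_trees G S" "pairwise (internally_disjoint S) F"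
  have "\<exists>w. (u, w) \<in> parcs T" if "T \<in> F" for T
    using S_tree_connected[of T G S u v] that F uv by (auto elim: converse_rtranclE)
  then obtain f where f: "\<And>T. T \<in> F \<Longrightarrow> (u, f T) \<in> parcs T" by metis
  have "inj_on f F"
  proof (rule inj_onI, rule ccontr)
    fix T T' assume T: "T \<in> F" "T' \<in> F" "f T = f T'" "T \<noteq> T'"
    then have "(u, f T) \<in> parcs T \<inter> parcs T'" using f by (metis IntI)
    moreover have "parcs T \<inter> parcs T' = {}"
      using F(2) T by (auto simp: pairwise_def internally_disjoint_def)
    ultimately show False by blast
  qed
  moreover have "finite {w. (u, w) \<in> parcs G}"
    using pair_graphD[OF G] by (auto intro: finite_subset[of _ "pverts G"])
  moreover have "f ` F \<subseteq> {w. (u, w) \<in> parcs G}"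
    using f F(1) by (auto simp: S_trees_def subgraph_def)
  ultimately show "card F \<le> card {w. (u, w) \<in> parcs G}" by (intro card_inj_on_le[of f])
qed

section \<open>Minimum vertex cuts\<close>

lemma finite_cut_sizes:
  assumes "pair_graph G"
  shows "finite {card X | X. X \<subseteq> pverts G \<and> P X}"
proof (rule finite_subset)
  show "{card X | X. X \<subseteq> pverts G \<and> P X} \<subseteq> card ` Pow (pverts G)" by auto
qed (use pair_graphD[OF assms] in simp)

lemma vertex_connectivity_le:
  assumes "pair_graph G" "X \<subseteq> pverts G"
    and "\<not> connected_in (parcs G) (pverts G - X) \<or> card (pverts G - X) \<le> 1"
  shows "vertex_connectivity G \<le> card X"
  unfolding vertex_connectivity_def
proof (rule Min_le[OF finite_cut_sizes[OF assms(1)]])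
  have "finite (pverts G - X)" using pair_graphD[OF assms(1)] by simp
  \<comment> \<open>Deleting all vertices counts as disconnecting, since the empty graph is not
    connected.\<close>
  then have "pverts G - X = {} \<or> card (pverts G - X) = 1"
    if "card (pverts G - X) \<le> 1" using that by (auto simp: le_Suc_eq)
  then show "card X \<in> {card X | X. X \<subseteq> pverts G \<and>
       (\<not> Digraph_Component.connected (with_proj G \<restriction> (pverts G - X)) \<or> card (pverts G - X) = 1)}"
    using assms(2,3) by (auto simp: connected_induce_iff[OF assms(1)])
qed

text \<open>Deleting everything except two non-adjacent vertices disconnects \<open>G\<close>. So a
  minimum deletion set leaves at least two vertices and truly disconnects, rather than leaving a
  single vertex.\<close>

lemma minimum_cut_exists:
  assumes G: "pair_graph G" and ne: "pverts G \<noteq> {}" and nc: "\<not> complete_graph G"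
  obtains X u v where "X \<subseteq> pverts G" "card X = vertex_connectivity G"
    "u \<in> pverts G - X" "v \<in> pverts G - X" "(u, v) \<notin> (parcs G \<inter> (pverts G - X) \<times> (pverts G - X))\<^sup>*"
proof -
  let ?K = "{card X | X. X \<subseteq> pverts G \<and>
       (\<not> Digraph_Component.connected (with_proj G \<restriction> (pverts G - X)) \<or> card (pverts G - X) = 1)}"
  note fin = pair_graphD(1)[OF G]
  have "card (pverts G) \<in> ?K"
    using connected_induce_iff[OF G, of "{}"] by (auto intro!: exI[of _ "pverts G"])
  then have "Min ?K \<in> ?K" using finite_cut_sizes[OF G] by (intro Min_in) auto
  then obtain X where X: "X \<subseteq> pverts G" "card X = vertex_connectivity G"
    "\<not> Digraph_Component.connected (with_proj G \<restriction> (pverts G - X)) \<or> card (pverts G - X) = 1"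
    unfolding vertex_connectivity_def by auto
  have cX: "card X + card (pverts G - X) = card (pverts G)"
    using X(1) fin by (metis card_Diff_subset card_mono finite_subset le_add_diff_inverse)
  have "\<exists>u v. u \<in> pverts G \<and> v \<in> pverts G \<and> u \<noteq> v \<and> (u, v) \<notin> parcs G"
  proof (rule ccontr)
    assume "\<not> ?thesis"
    then have "parcs G = {(u, v). (u, v) \<in> pverts G \<times> pverts G \<and> u \<noteq> v}" using pair_graphD[OF G] by auto
    then show False using nc fin by (simp add: complete_graph_def complete_digraph_pair_def)
  qed
  then obtain u v where uv: "u \<in> pverts G" "v \<in> pverts G" "u \<noteq> v" "(u, v) \<notin> parcs G" by blast
  have "pverts G - (pverts G - {u, v}) = {u, v}" using uv by auto
  moreover have "\<not> connected_in (parcs G) {u, v}"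
  proof
    assume "connected_in (parcs G) {u, v}"
    then have "(u, v) \<in> (parcs G \<inter> {u, v} \<times> {u, v})\<^sup>*" by (auto simp: connected_in_def)
    moreover have "parcs G \<inter> {u, v} \<times> {u, v} = {}"
      using uv pair_graphD(5)[OF G] symD[OF pair_graphD(4)[OF G]] by auto
    ultimately show False using uv(3) by simp
  qed
  ultimately have "vertex_connectivity G \<le> card (pverts G - {u, v})"
    by (intro vertex_connectivity_le[OF G]) auto
  moreover have "card (pverts G - {u, v}) + 2 = card (pverts G)"
  proof -
    have "card {u, v} \<le> card (pverts G)" using uv fin by (intro card_mono) auto
    then show ?thesis using uv fin by (simp add: card_Diff_subset)
  qed
  ultimately have "2 \<le> card (pverts G - X)" using X(2) cX by linarith
  then have "pverts G - X \<noteq> {}" "card (pverts G - X) \<noteq> 1"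
    by (metis card.empty not_numeral_le_zero, linarith)
  then have "\<not> connected_in (parcs G) (pverts G - X)"
    using X(3) connected_induce_iff[OF G] by blast
  then show thesis using that X(1,2) unfolding connected_in_def by blast
qed

section \<open>The cut bound for lexicographic products\<close>

lemma pair_graph_lex_product:
  assumes G: "pair_graph G" and H: "pair_graph H"
  shows "pair_graph (lex_product G H)"
  unfolding lex_product_def
proof (rule pair_graphI)
  show "finite (pverts G \<times> pverts H)" using pair_graphD[OF G] pair_graphD[OF H] by simp
qed (use pair_graphD[OF G] pair_graphD[OF H] in \<open>auto simp: sym_def\<close>)

text \<open>The cut argument asks for a third terminal off \<open>X \<times> V(H)\<close>. If none
  is left, \<open>H\<close> is a single vertex and all neighbours of \<open>u\<close> lie in
  \<open>X\<close>, so the degree of \<open>(u, h)\<close> gives the same bound.\<close>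

lemma gen_connectivity_lex_product_le:
  fixes G :: "'a pair_pre_digraph" and H :: "'b pair_pre_digraph"
  assumes G: "pair_graph G" and conn: "Digraph_Component.connected (with_proj G)"
    and nc: "\<not> complete_graph G" and H: "pair_graph H" and Hne: "pverts H \<noteq> {}"
  shows "gen_connectivity 3 (lex_product G H) \<le> vertex_connectivity G * card (pverts H)"
proof -
  let ?P = "lex_product G H"
  note fin = pair_graphD(1)[OF G] pair_graphD(1)[OF H]
  note connG = conn[unfolded connected_pair_graph_iff[OF G]]
  obtain X u v where X: "X \<subseteq> pverts G" "card X = vertex_connectivity G"
    and uv: "u \<in> pverts G - X" "v \<in> pverts G - X"
    and sep: "(u, v) \<notin> (parcs G \<inter> (pverts G - X) \<times> (pverts G - X))\<^sup>*"
    using minimum_cut_exists[OF G _ nc] connG by blast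
  obtain h where h: "h \<in> pverts H" using Hne by blast
  let ?Y = "X \<times> pverts H"
  have finX: "finite X" using X(1) fin(1) by (rule finite_subset)
  have Y: "finite ?Y" "card ?Y = vertex_connectivity G * card (pverts H)"
    using X(2) finX fin by (auto simp: card_cartesian_product)
  have neq: "u \<noteq> v" using sep by auto
  have P: "pair_graph ?P" by (rule pair_graph_lex_product[OF G H])
  have bound: "gen_connectivity 3 ?P \<le> card ?Y"
    if "S \<subseteq> pverts ?P" "card S = 3" "tree_connectivity ?P S \<le> card ?Y" for S
    using gen_connectivity_le[OF P that(1,2)] that(3) by simp
  show ?thesis
  proof (cases "\<exists>w\<in>(pverts G - X) \<times> pverts H. w \<noteq> (u, h) \<and> w \<noteq> (v, h)")
    case True
    then obtain w where w: "w \<in> (pverts G - X) \<times> pverts H" "w \<noteq> (u, h)" "w \<noteq> (v, h)" by blast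
    let ?S = "{(u, h), (v, h), w}"
    have "separates (parcs ?P) ?Y {(u, h)} {(v, h)}"
      unfolding separates_def
    proof (intro ballI notI)
      fix a b assume "a \<in> {(u, h)} - ?Y" "b \<in> {(v, h)} - ?Y"
        "(a, b) \<in> (parcs ?P \<inter> (- ?Y) \<times> (- ?Y))\<^sup>*"
      then have "((u, h), (v, h)) \<in> (parcs ?P \<inter> (- ?Y) \<times> (- ?Y))\<^sup>*" by simp
      \<comment> \<open>Projected to \<open>G\<close>, each step stays put or follows an arc
        avoiding \<open>X\<close>. Writing \<open>fst (v, h)\<close> lets the induction vary the end
        of the walk.\<close>
      then have "(u, fst (v, h)) \<in> (parcs G \<inter> (pverts G - X) \<times> (pverts G - X))\<^sup>*"
      proof (induction rule: rtrancl_induct)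
        case (step y z)
        then have "fst y = fst z \<or> (fst y, fst z) \<in> parcs G \<inter> (pverts G - X) \<times> (pverts G - X)"
          by (auto simp: lex_product_def)
        with step.IH show ?case by (metis rtrancl.rtrancl_into_rtrancl)
      qed simp
      then show False using sep by simp
    qed
    then have "tree_connectivity ?P ?S \<le> card ?Y"
      using uv w by (intro tree_connectivity_le_cut[OF P, of "(u, h)" _ "(v, h)"] Y(1)) auto
    moreover have "?S \<subseteq> pverts ?P" using uv w h by (auto simp: lex_product_def)
    moreover have "card ?S = 3" using neq w by auto
    ultimately show ?thesis using bound Y(2) by metis
  next
    case False
    then have UV: "pverts G - X = {u, v}" using uv h by blast
    have Hh: "pverts H = {h}"
    proof -
      have "h' = h" if "h' \<in> pverts H" for h'
        using False uv that neq by auto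
      then show ?thesis using h by blast
    qed
    have "(u, v) \<notin> parcs G" using sep uv by blast
    \<comment> \<open>The third terminal now has to come from \<open>X\<close>, which is nonempty
      because \<open>G\<close> is connected.\<close>
    have "X \<noteq> {}"
    proof
      assume "X = {}"
      then show False using connG sep uv by (auto simp: connected_in_def)
    qed
    then obtain x where x: "x \<in> X" by blast
    let ?S = "{(u, h), (v, h), (x, h)}"
    have "w \<in> X" if "(u, w) \<in> parcs G" for w
    proof (rule ccontr)
      assume "w \<notin> X"
      then have "w \<in> {u, v}" using UV that pair_graphD(3)[OF G] by blast
      then show False using that pair_graphD(5)[OF G] \<open>(u, v) \<notin> parcs G\<close> by blast
    qed
    then have "{w. ((u, h), w) \<in> parcs ?P} \<subseteq> ?Y"
      using Hh pair_graphD(5)[OF H] by (auto simp: lex_product_def)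
    then have "card {w. ((u, h), w) \<in> parcs ?P} \<le> card ?Y" using Y(1) by (intro card_mono)
    then have "tree_connectivity ?P ?S \<le> card ?Y"
      using tree_connectivity_le_degree[OF P, of "(u, h)" ?S "(v, h)"] neq by auto
    moreover have "?S \<subseteq> pverts ?P" using uv x X(1) h by (auto simp: lex_product_def)
    moreover have "x \<noteq> u" "x \<noteq> v" using x uv by auto
    then have "card ?S = 3" using neq by simp
    ultimately show ?thesis using bound Y(2) by metis
  qed
qed

section \<open>Blowing up the terminals\<close>

text \<open>
  Every terminal is replaced by \<open>k\<close> copies, and an edge \<open>st\<close> between two terminals by a single vertex
  \<open>Mid {s, t}\<close> adjacent to all copies of \<open>s\<close> and \<open>t\<close>, so that disjoint pieces of the blow-up
  never use the same edge of the graph twice.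
\<close>

datatype 'a node = Vtx 'a | Copy 'a nat | Mid "'a set"

primrec ends :: "'a node \<Rightarrow> 'a set" where
  "ends (Vtx v) = {v}"
| "ends (Copy s i) = {s}"
| "ends (Mid e) = e"

definition blowup_half :: "'a pair_pre_digraph \<Rightarrow> 'a set \<Rightarrow> nat \<Rightarrow> 'a node rel" where
  "blowup_half G S k =
     {(Vtx u, Vtx v) | u v. (u, v) \<in> parcs G \<and> u \<notin> S \<and> v \<notin> S} \<union>
     {(Copy s i, Vtx v) | s i v. (s, v) \<in> parcs G \<and> s \<in> S \<and> v \<notin> S \<and> i < k} \<union>
     {(Copy s i, Mid {s, t}) | s i t. (s, t) \<in> parcs G \<and> s \<in> S \<and> t \<in> S \<and> i < k}"

definition blowup :: "'a pair_pre_digraph \<Rightarrow> 'a set \<Rightarrow> nat \<Rightarrow> 'a node rel" where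
  "blowup G S k = blowup_half G S k \<union> (blowup_half G S k)\<inverse>"

definition copies :: "nat \<Rightarrow> 'a \<Rightarrow> 'a node set" where
  "copies k s = Copy s ` {..<k}"

lemma sym_blowup: "sym (blowup G S k)"
  by (auto simp: blowup_def sym_def)

lemma finite_blowup:
  assumes "pair_graph G" shows "finite (blowup G S k)"
proof -
  note G = pair_graphD[OF assms]
  let ?N = "Vtx ` pverts G \<union> (\<lambda>(s, i). Copy s i) ` (pverts G \<times> {..<k}) \<union> Mid ` Pow (pverts G)"
  have "blowup_half G S k \<subseteq> ?N \<times> ?N"
    using G(3) by (auto simp: blowup_half_def image_iff)
  moreover have "finite ?N" using G(1) by simp
  ultimately show ?thesis by (auto simp: blowup_def intro: finite_subset)
qed

lemma blowup_vtx: "(u, v) \<in> parcs G \<Longrightarrow> u \<notin> S \<Longrightarrow> v \<notin> S \<Longrightarrow> (Vtx u, Vtx v) \<in> blowup G S k"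
  and blowup_copy: "(s, v) \<in> parcs G \<Longrightarrow> s \<in> S \<Longrightarrow> v \<notin> S \<Longrightarrow> i < k \<Longrightarrow> (Copy s i, Vtx v) \<in> blowup G S k"
  and blowup_mid: "(s, t) \<in> parcs G \<Longrightarrow> s \<in> S \<Longrightarrow> t \<in> S \<Longrightarrow> i < k \<Longrightarrow> (Copy s i, Mid {s, t}) \<in> blowup G S k"
  by (auto simp: blowup_def blowup_half_def)

text \<open>The usual notion of a \<open>k\<close>-connected graph.\<close>

definition highly_connected :: "nat \<Rightarrow> 'a pair_pre_digraph \<Rightarrow> bool" where
  "highly_connected k G \<longleftrightarrow>
     (\<forall>X\<subseteq>pverts G. card X < k \<longrightarrow> connected_in (parcs G) (pverts G - X) \<and> 2 \<le> card (pverts G - X))"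

text \<open>Deleting fewer than \<open>k\<close> neighbours would isolate \<open>a\<close> while
  another vertex remains.\<close>

lemma highly_connected_degree:
  assumes G: "pair_graph G" and k: "highly_connected k G" and a: "a \<in> pverts G"
  shows "k \<le> card {v. (a, v) \<in> parcs G}"
proof (rule ccontr)
  let ?N = "{v. (a, v) \<in> parcs G}"
  assume "\<not> ?thesis"
  moreover have "?N \<subseteq> pverts G" using pair_graphD(3)[OF G] by blast
  ultimately have conn: "connected_in (parcs G) (pverts G - ?N)" and card: "2 \<le> card (pverts G - ?N)"
    using k by (auto simp: highly_connected_def)
  have aN: "a \<in> pverts G - ?N" using a pair_graphD(5)[OF G] by simp
  have "pverts G - ?N \<noteq> {a}" using card by auto
  then obtain b where b: "b \<in> pverts G - ?N" "b \<noteq> a" using aN by blast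
  then have "(a, b) \<in> (parcs G \<inter> (pverts G - ?N) \<times> (pverts G - ?N))\<^sup>*"
    using conn aN by (auto simp: connected_in_def)
  then show False using b(2) by (cases rule: converse_rtranclE) auto
qed

text \<open>A separator with fewer than \<open>k\<close> nodes misses a copy of every terminal, so
  one free copy per terminal is followed through \<open>G\<close>. The non-terminals it cuts form
  \<open>Y0\<close>. If one more deletion is affordable, \<open>a\<close> is deleted together with
  \<open>Y0\<close> and the walk starts at a neighbour; otherwise no middle node is cut and deleting
  \<open>Y0\<close> alone suffices.\<close>

lemma linked_blowup:
  assumes G: "pair_graph G" and k: "highly_connected k G"
    and S: "S = {a, b, c}" "a \<noteq> b" "a \<noteq> c" "S \<subseteq> pverts G"
  shows "linked (blowup G S k) (copies k a) (copies k b \<union> copies k c)"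
proof -
  have "k \<le> card Y" if Y: "finite Y"
    and sep: "separates (blowup G S k) Y (copies k a) (copies k b \<union> copies k c)" for Y
  proof (rule ccontr)
    assume "\<not> k \<le> card Y"
    then have lt: "card Y < k" by simp
    note E = pair_graphD[OF G]
    define r where "r = blowup G S k \<inter> (- Y) \<times> (- Y)"
    have sym_r: "sym r" using sym_blowup by (auto simp: r_def intro: sym_restrict)
    have fresh: "\<exists>i<k. Copy s i \<notin> Y" for s :: 'a
    proof (rule ccontr)
      assume "\<not> ?thesis"
      then have "copies k s \<subseteq> Y" by (auto simp: copies_def)
      then have "card (copies k s) \<le> card Y" using Y by (rule card_mono[rotated])
      then show False using lt by (simp add: copies_def card_image inj_on_def)
    qed
    then obtain \<iota> where \<iota>: "\<And>s. \<iota> s < k" "\<And>s. Copy s (\<iota> s) \<notin> Y" by metis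
    let ?a = "Copy a (\<iota> a)"
    have unreach: "(?a, Copy t (\<iota> t)) \<notin> r\<^sup>*" if "t \<in> {b, c}" for t
      using sep that \<iota> unfolding separates_def r_def copies_def by blast
    define Y0 where "Y0 = {v \<in> pverts G - S. Vtx v \<in> Y}"
    have Y0: "Y0 \<subseteq> pverts G" "Vtx ` Y0 \<subseteq> Y" "card (Vtx ` Y0) = card Y0" "finite Y0"
      using E(1) by (auto simp: Y0_def card_image inj_on_def)
    \<comment> \<open>The non-terminals reached from the free copy of \<open>a\<close>. This set is
      closed under arcs avoiding \<open>Y0\<close> and \<open>a\<close>, because an arc into
      \<open>b\<close> or \<open>c\<close> would reach their free copies.\<close>
    define \<rho> where "\<rho> = {v. v \<notin> S \<and> (?a, Vtx v) \<in> r\<^sup>*}"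
    have \<rho>_step: "w \<in> \<rho>" if "u \<in> \<rho>" "(u, w) \<in> parcs G" "w \<notin> Y0" "w \<noteq> a" for u w
    proof -
      have u: "u \<notin> S" "(?a, Vtx u) \<in> r\<^sup>*" using that by (auto simp: \<rho>_def)
      have "?a \<in> - Y" using \<iota> by simp
      then have "Vtx u \<notin> Y" using u(2) unfolding r_def by (blast dest: rtrancl_restrict_mem)
      have wu: "(w, u) \<in> parcs G" using that(2) E(4) by (rule symD[rotated])
      show ?thesis
      proof (cases "w \<in> S")
        case True
        then have "w \<in> {b, c}" using S(1) that(4) by blast
        moreover have "(Vtx u, Copy w (\<iota> w)) \<in> r"
          using blowup_copy[OF wu True u(1) \<iota>(1), of w] sym_blowup[of G S k] \<iota>(2) \<open>Vtx u \<notin> Y\<close>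
          by (auto simp: r_def dest: symD)
        ultimately show ?thesis using unreach u(2) by (meson rtrancl.rtrancl_into_rtrancl)
      next
        case False
        then have "Vtx w \<notin> Y" using that E(3) by (auto simp: Y0_def)
        then have "(Vtx u, Vtx w) \<in> r"
          using blowup_vtx[OF that(2) u(1) False] \<open>Vtx u \<notin> Y\<close> by (auto simp: r_def)
        then show ?thesis using u(2) False by (auto simp: \<rho>_def)
      qed
    qed
    \<comment> \<open>A middle node outside \<open>Y\<close> would give a walk of length two to the
      free copy of \<open>t\<close>.\<close>
    have mid: "Mid {a, t} \<in> Y" if "(a, t) \<in> parcs G" "t \<in> S" for t
    proof (rule ccontr)
      assume M: "Mid {a, t} \<notin> Y"
      have t: "t \<in> {b, c}" using that S E(5) by auto
      have ta: "(t, a) \<in> parcs G" using that(1) E(4) by (rule symD[rotated])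
      have "(?a, Mid {a, t}) \<in> r"
        using blowup_mid[OF that(1) _ that(2) \<iota>(1)] S(1) M \<iota>(2) by (auto simp: r_def)
      moreover have "(Copy t (\<iota> t), Mid {a, t}) \<in> r"
        using blowup_mid[OF ta that(2) _ \<iota>(1)] S(1) M \<iota>(2) by (auto simp: r_def insert_commute)
      ultimately show False using unreach[OF t] symD[OF sym_r] by (meson converse_rtrancl_into_rtrancl r_into_rtrancl)
    qed
    have nb: "w \<in> \<rho>" if "(a, w) \<in> parcs G" "w \<notin> S" "Vtx w \<notin> Y" for w
    proof -
      have "(?a, Vtx w) \<in> r"
        using blowup_copy[OF that(1) _ that(2) \<iota>(1)] S(1) that(3) \<iota>(2) by (auto simp: r_def)
      then show ?thesis using that(2) by (auto simp: \<rho>_def)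
    qed
    have bG: "b \<in> pverts G" "b \<notin> Y0" "b \<noteq> a" "b \<notin> \<rho>" and aG: "a \<in> pverts G" "a \<notin> Y0"
      using S by (auto simp: Y0_def \<rho>_def)
    show False
    proof (cases "card Y0 + 1 < k")
      case True
      \<comment> \<open>\<open>\<phi> v\<close> is the node by which the edge \<open>av\<close>
        leaves a copy of \<open>a\<close>. As \<open>a\<close> has at least \<open>k\<close>
        neighbours, one such node escapes \<open>Y\<close>, and by \<open>mid\<close> it is not a
        middle node.\<close>
      define \<phi> where "\<phi> v = (if v \<in> S then Mid {a, v} else Vtx v)" for v
      have "inj \<phi>" by (auto simp: inj_def \<phi>_def doubleton_eq_iff)
      then have "card (\<phi> ` {v. (a, v) \<in> parcs G}) = card {v. (a, v) \<in> parcs G}"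
        by (meson card_image inj_on_subset subset_UNIV)
      then have "\<not> \<phi> ` {v. (a, v) \<in> parcs G} \<subseteq> Y"
        using highly_connected_degree[OF G k aG(1)] card_mono[OF Y] lt by (metis leD order_trans)
      then obtain v where v: "(a, v) \<in> parcs G" "\<phi> v \<notin> Y" by blast
      have vS: "v \<notin> S" "Vtx v \<notin> Y" using v mid by (auto simp: \<phi>_def split: if_splits)
      let ?X = "insert a Y0"
      have "card ?X < k" using True Y0(4) by (simp add: card_insert_if)
      then have "connected_in (parcs G) (pverts G - ?X)"
        using k Y0(1) aG by (auto simp: highly_connected_def)
      moreover have "v \<in> pverts G - ?X" using v(1) vS S(1) E(3) by (auto simp: Y0_def)
      ultimately have "(v, b) \<in> (parcs G \<inter> (pverts G - ?X) \<times> (pverts G - ?X))\<^sup>*"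
        using bG by (auto simp: connected_in_def)
      then have "b \<in> \<rho>"
        by (induction rule: rtrancl_induct) (use nb[OF v(1) vS] \<rho>_step in auto)
      then show False using bG by blast
    next
      case False
      \<comment> \<open>Here \<open>Y0\<close> accounts for all of \<open>Y\<close>. Thus no middle
        node is cut, \<open>mid\<close> leaves \<open>a\<close> without terminal neighbours, and
        walks through \<open>a\<close> do no harm.\<close>
      then have "card (Vtx ` Y0) = card Y" using Y0(3) lt card_mono[OF Y Y0(2)] by linarith
      then have YV: "Y = Vtx ` Y0" using card_subset_eq[OF Y Y0(2)] by simp
      have "connected_in (parcs G) (pverts G - Y0)"
        using k Y0(1,3) lt YV by (auto simp: highly_connected_def)
      then have "(a, b) \<in> (parcs G \<inter> (pverts G - Y0) \<times> (pverts G - Y0))\<^sup>*"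
        using aG bG by (auto simp: connected_in_def)
      then have "b = a \<or> b \<in> \<rho>"
      proof (induction rule: rtrancl_induct)
        case (step u w)
        show ?case
        proof (cases "u = a")
          case True
          then have "w \<notin> S" using step.hyps(2) mid YV by auto
          then show ?thesis using nb step.hyps(2) True YV by auto
        next
          case False
          then show ?thesis using step.IH step.hyps(2) \<rho>_step by blast
        qed
      qed simp
      then show False using bG by blast
    qed
  qed
  moreover have "card (copies k a) = k" by (simp add: copies_def card_image inj_on_def)
  ultimately show ?thesis by (simp add: linked_def)
qed

section \<open>Projecting the blow-up back to the graph\<close>

definition shadow_verts :: "'a pair_pre_digraph \<Rightarrow> 'a set \<Rightarrow> 'a node set \<Rightarrow> 'a set" where
  "shadow_verts G S U = S \<union> {v \<in> pverts G. v \<notin> S \<and> Vtx v \<in> U}"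

definition shadow_arcs :: "'a pair_pre_digraph \<Rightarrow> 'a set \<Rightarrow> 'a node set \<Rightarrow> 'a rel" where
  "shadow_arcs G S U = {(u, v) \<in> parcs G. u \<in> shadow_verts G S U \<and> v \<in> shadow_verts G S U \<and>
     (u \<in> S \<and> v \<in> S \<longrightarrow> Mid {u, v} \<in> U)}"

lemma shadow_arcs_mono: "U \<subseteq> U' \<Longrightarrow> shadow_arcs G S U \<subseteq> shadow_arcs G S U'"
  by (auto simp: shadow_arcs_def shadow_verts_def)

text \<open>All terminals belong to every shadow. A common arc would join two terminals, and then
  its middle node would lie in both sets.\<close>

lemma shadow_disjoint:
  assumes "U \<inter> U' = {}"
  shows "shadow_verts G S U \<inter> shadow_verts G S U' = S" "shadow_arcs G S U \<inter> shadow_arcs G S U' = {}"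
  using assms by (auto simp: shadow_arcs_def shadow_verts_def)

lemma sym_shadow_arcs: "pair_graph G \<Longrightarrow> sym (shadow_arcs G S U)"
  using pair_graphD(4)[of G] by (auto simp: shadow_arcs_def sym_def insert_commute)

text \<open>Along a step, each end of the new node is an end of the old one or is joined to one by a
  shadow arc. Middle nodes have two ends, hence the claim for every \<open>q\<close>.\<close>

lemma blowup_walk_shadow:
  assumes G: "pair_graph G" and "(Copy s i, y) \<in> (blowup G S k \<inter> D \<times> D)\<^sup>*" "q \<in> ends y"
  shows "(s, q) \<in> (shadow_arcs G S D)\<^sup>*"
  using assms(2,3)
proof (induction arbitrary: q rule: rtrancl_induct)
  case base
  then show ?case by simp
next
  case (step y z)
  note E = pair_graphD[OF G]
  have D: "y \<in> D" "z \<in> D" and yz: "(y, z) \<in> blowup_half G S k \<or> (z, y) \<in> blowup_half G S k"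
    using step.hyps(2) by (auto simp: blowup_def)
  have "\<exists>p\<in>ends y. p = q \<or> (p, q) \<in> shadow_arcs G S D"
    using yz
  proof
    assume "(y, z) \<in> blowup_half G S k"
    then show ?thesis
      using D step.prems E(3) by (auto simp: blowup_half_def shadow_arcs_def shadow_verts_def)
  next
    assume "(z, y) \<in> blowup_half G S k"
    then show ?thesis
      using D step.prems E(3) symD[OF E(4)]
      by (auto simp: blowup_half_def shadow_arcs_def shadow_verts_def)
  qed
  then obtain p where p: "p \<in> ends y" "p = q \<or> (p, q) \<in> shadow_arcs G S D" by blast
  from step.IH[OF p(1)] p(2) show ?case by (auto intro: rtrancl_into_rtrancl)
qed

text \<open>The pieces may contain different copies of \<open>s\<close>; projection identifies them
  and so joins the two shadows. Taking \<open>D = D'\<close> covers a piece that meets all three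
  terminals.\<close>

lemma shadow_tree:
  assumes G: "pair_graph G" and S: "S = {s, t, t'}" "S \<subseteq> pverts G"
    and D: "connected_in (blowup G S k) D" "connected_in (blowup G S k) D'"
    and s: "Copy s i \<in> D" "Copy s i' \<in> D'" and t: "Copy t j \<in> D" "Copy t' j' \<in> D'"
  shows "\<exists>F\<subseteq>shadow_arcs G S (D \<union> D').
    \<lparr>pverts = shadow_verts G S (D \<union> D'), parcs = F\<rparr> \<in> S_trees G S"
proof -
  let ?W = "shadow_verts G S (D \<union> D')" and ?A = "shadow_arcs G S (D \<union> D')"
  note E = pair_graphD[OF G]
  have AW: "?A \<subseteq> ?W \<times> ?W" by (auto simp: shadow_arcs_def)
  have W: "finite ?W" "?W \<noteq> {}" "?W \<subseteq> pverts G" using E(1) S by (auto simp: shadow_verts_def intro: finite_subset)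
  have reach: "(s, q) \<in> ?A\<^sup>*" if "y \<in> D \<union> D'" "q \<in> ends y" for y q
    using that(1)
  proof
    assume "y \<in> D"
    then have "(Copy s i, y) \<in> (blowup G S k \<inter> D \<times> D)\<^sup>*" using D(1) s(1) by (auto simp: connected_in_def)
    then have "(s, q) \<in> (shadow_arcs G S D)\<^sup>*" using that(2) by (rule blowup_walk_shadow[OF G])
    then show ?thesis using rtrancl_mono[OF shadow_arcs_mono[of D "D \<union> D'" G S]] by blast
  next
    assume "y \<in> D'"
    then have "(Copy s i', y) \<in> (blowup G S k \<inter> D' \<times> D')\<^sup>*" using D(2) s(2) by (auto simp: connected_in_def)
    then have "(s, q) \<in> (shadow_arcs G S D')\<^sup>*" using that(2) by (rule blowup_walk_shadow[OF G])
    then show ?thesis using rtrancl_mono[OF shadow_arcs_mono[of D' "D \<union> D'" G S]] by blast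
  qed
  have "(s, q) \<in> ?A\<^sup>*" if q: "q \<in> ?W" for q
  proof -
    consider "q = s" | "q = t" | "q = t'" | "Vtx q \<in> D \<union> D'"
      using q S(1) by (auto simp: shadow_verts_def)
    then show ?thesis
      using reach[of "Copy s i" q] reach[of "Copy t j" q] reach[of "Copy t' j'" q] reach[of "Vtx q" q] s t
      by cases auto
  qed
  then have "connected_in ?A ?W"
    using AW by (intro connected_in_root[OF sym_shadow_arcs[OF G], of _ s]) (simp add: Int_absorb2)
  then obtain F where F: "F \<subseteq> ?A" "undirected_tree \<lparr>pverts = ?W, parcs = F\<rparr>"
    using spanning_tree_exists[OF W(1,2) AW sym_shadow_arcs[OF G]] by blast
  have "pair_wf_digraph G" "pair_wf_digraph \<lparr>pverts = ?W, parcs = F\<rparr>"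
    using E(3) F(1) AW by (auto simp: pair_wf_digraph_def)
  then have "subgraph (with_proj \<lparr>pverts = ?W, parcs = F\<rparr>) (with_proj G)"
    using W(3) F(1) by (auto simp: subgraph_def wf_digraph_wp_iff shadow_arcs_def)
  then show ?thesis using F by (intro exI[of _ F]) (auto simp: S_trees_def shadow_verts_def)
qed

text \<open>Each tree joins two different terminals and so has an arc; being arc-disjoint, the trees
  of different node sets are distinct.\<close>

lemma tree_connectivity_ge_disjoint_unions:
  assumes G: "pair_graph G" and S: "S \<subseteq> pverts G" "2 \<le> card S" and \<U>: "disjoint \<U>"
    and tree: "\<And>U. U \<in> \<U> \<Longrightarrow> \<exists>F\<subseteq>shadow_arcs G S U. \<lparr>pverts = shadow_verts G S U, parcs = F\<rparr> \<in> S_trees G S"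
  shows "card \<U> \<le> tree_connectivity G S"
proof -
  obtain \<tau> where \<tau>: "\<And>U. U \<in> \<U> \<Longrightarrow> \<tau> U \<subseteq> shadow_arcs G S U \<and> \<lparr>pverts = shadow_verts G S U, parcs = \<tau> U\<rparr> \<in> S_trees G S"
    using tree by metis
  define T where "T U = \<lparr>pverts = shadow_verts G S U, parcs = \<tau> U\<rparr>" for U
  have disj: "internally_disjoint S (T U) (T U')" if "U \<in> \<U>" "U' \<in> \<U>" "U \<noteq> U'" for U U'
  proof -
    have "U \<inter> U' = {}" using \<U> that by (auto dest: disjointD)
    from shadow_disjoint[OF this, of G S] \<tau>[OF that(1)] \<tau>[OF that(2)]
    show ?thesis by (auto simp: internally_disjoint_def T_def)
  qed
  have nonempty: "\<tau> U \<noteq> {}" if "U \<in> \<U>" for U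
  proof
    assume e: "\<tau> U = {}"
    obtain u v where uv: "u \<in> S" "v \<in> S" "u \<noteq> v"
      using S(2) by (metis card_2_iff' obtain_subset_with_card_n subsetD)
    from S_tree_connected[OF conjunct2[OF \<tau>[OF that]] uv(1,2)] e uv(3) show False by simp
  qed
  have "inj_on T \<U>"
  proof (rule inj_onI, rule ccontr)
    fix U U' assume U: "U \<in> \<U>" "U' \<in> \<U>" "T U = T U'" "U \<noteq> U'"
    have "\<tau> U = \<tau> U'" using U(3) by (simp add: T_def)
    with disj[OF U(1,2,4)] nonempty[OF U(1)] show False by (auto simp: internally_disjoint_def T_def)
  qed
  moreover have "pairwise (internally_disjoint S) (T ` \<U>)" using disj by (auto simp: pairwise_def)
  moreover have "T ` \<U> \<subseteq> S_trees G S" using \<tau> by (auto simp: T_def)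
  ultimately show ?thesis using tree_connectivity_ge[OF G] by (metis card_image)
qed

section \<open>The lower bound on the generalised 3-connectivity\<close>

text \<open>Sending each vertex of \<open>A\<close> to the piece containing it is a
  bijection.\<close>

lemma card_pieces_meeting:
  assumes "disjoint \<D>" "A \<subseteq> \<Union>\<D>" "\<And>D. D \<in> \<D> \<Longrightarrow> at_most_one (D \<inter> A)" "finite A"
  shows "finite {D \<in> \<D>. D \<inter> A \<noteq> {}}" "card {D \<in> \<D>. D \<inter> A \<noteq> {}} = card A"
proof -
  have "\<forall>a\<in>A. \<exists>D. D \<in> \<D> \<and> a \<in> D" using assms(2) by blast
  then obtain f where f: "\<And>a. a \<in> A \<Longrightarrow> f a \<in> \<D> \<and> a \<in> f a" by metis
  have "D = f a" if "D \<in> \<D>" "a \<in> D" "a \<in> A" for D a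
    using disjointD[OF assms(1), of D "f a"] f that by blast
  then have im: "f ` A = {D \<in> \<D>. D \<inter> A \<noteq> {}}" using f by blast
  moreover have "inj_on f A"
    using f assms(3) unfolding inj_on_def at_most_one_def by (metis IntI)
  ultimately show "finite {D \<in> \<D>. D \<inter> A \<noteq> {}}" "card {D \<in> \<D>. D \<inter> A \<noteq> {}} = card A"
    using assms(4) by (metis finite_imageI, metis card_image)
qed

text \<open>Two elements of each class form three mixed pairs, which lowers \<open>m\<close> by two.
  For \<open>m = 1\<close> one pair is formed and one element is left over.\<close>

lemma pairing_three_classes:
  assumes "finite X" "finite Y" "finite Z" "card X = m" "card Y = m" "card Z = m"
    and "X \<inter> Y = {}" "X \<inter> Z = {}" "Y \<inter> Z = {}"
  shows "\<exists>\<Q>. finite \<Q> \<and> disjoint \<Q> \<and> card \<Q> = m + m div 2 \<and>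
    (\<forall>g\<in>\<Q>. \<exists>p q. g = {p, q} \<and> (p \<in> X \<and> q \<in> Y \<or> p \<in> X \<and> q \<in> Z \<or> p \<in> Y \<and> q \<in> Z))"
  using assms
proof (induction m arbitrary: X Y Z rule: less_induct)
  case (less m)
  note dj = less.prems(7-9)
  consider "m = 0" | "m = 1" | n where "m = Suc (Suc n)" by (metis One_nat_def not0_implies_Suc)
  then show ?case
  proof cases
    case 1
    then show ?thesis by (intro exI[of _ "{}"]) auto
  next
    case 2
    then obtain x y where "X = {x}" "Y = {y}" using less.prems by (metis card_1_singletonE)
    then show ?thesis using 2 by (intro exI[of _ "{{x, y}}"]) (auto simp: disjoint_def)
  next
    case 3
    have split: "\<exists>x1 x2 X'. x1 \<noteq> x2 \<and> W = {x1, x2} \<union> X' \<and> x1 \<notin> X' \<and> x2 \<notin> X' \<and> finite X' \<and> card X' = n"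
      if "card W = m" "finite W" for W :: "'a set"
      using that unfolding 3 card_Suc_eq_finite by auto
    obtain x1 x2 X' where x: "x1 \<noteq> x2" "X = {x1, x2} \<union> X'" "x1 \<notin> X'" "x2 \<notin> X'" "finite X'" "card X' = n"
      using split[OF less.prems(4,1)] by blast
    obtain y1 y2 Y' where y: "y1 \<noteq> y2" "Y = {y1, y2} \<union> Y'" "y1 \<notin> Y'" "y2 \<notin> Y'" "finite Y'" "card Y' = n"
      using split[OF less.prems(5,2)] by blast
    obtain z1 z2 Z' where z: "z1 \<noteq> z2" "Z = {z1, z2} \<union> Z'" "z1 \<notin> Z'" "z2 \<notin> Z'" "finite Z'" "card Z' = n"
      using split[OF less.prems(6,3)] by blast
    have "\<exists>\<Q>. finite \<Q> \<and> disjoint \<Q> \<and> card \<Q> = n + n div 2 \<and>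
      (\<forall>g\<in>\<Q>. \<exists>p q. g = {p, q} \<and> (p \<in> X' \<and> q \<in> Y' \<or> p \<in> X' \<and> q \<in> Z' \<or> p \<in> Y' \<and> q \<in> Z'))"
      by (rule less.IH) (use x y z 3 dj in auto)
    then obtain \<Q> where Q: "finite \<Q>" "disjoint \<Q>" "card \<Q> = n + n div 2"
      "\<And>g. g \<in> \<Q> \<Longrightarrow> \<exists>p q. g = {p, q} \<and> (p \<in> X' \<and> q \<in> Y' \<or> p \<in> X' \<and> q \<in> Z' \<or> p \<in> Y' \<and> q \<in> Z')"
      by blast
    have sub: "g \<subseteq> X' \<union> Y' \<union> Z'" if "g \<in> \<Q>" for g using Q(4)[OF that] by auto
    let ?N = "{{x1, y1}, {x2, z1}, {y2, z2}}"
    have new: "h \<inter> (X' \<union> Y' \<union> Z') = {}" "h \<noteq> {}" if "h \<in> ?N" for h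
      using that x y z dj by auto
    have ds: "x1 \<noteq> y1" "x1 \<noteq> z1" "x1 \<noteq> y2" "x1 \<noteq> z2" "x2 \<noteq> y1" "x2 \<noteq> z1" "x2 \<noteq> y2" "x2 \<noteq> z2"
      "y1 \<noteq> z1" "y1 \<noteq> z2" "y2 \<noteq> z1" "y2 \<noteq> z2"
      using x(2) y(2) z(2) dj by auto
    have N: "disjoint ?N" "card ?N = 3"
      using ds x(1) y(1) z(1) by (auto simp: disjoint_def doubleton_eq_iff)
    have cross: "g \<inter> h = {}" if "g \<in> \<Q>" "h \<in> ?N" for g h
      using sub[OF that(1)] new(1)[OF that(2)] by blast
    have "disjoint (\<Q> \<union> ?N)"
    proof (rule disjointI)
      fix g h assume "g \<in> \<Q> \<union> ?N" "h \<in> \<Q> \<union> ?N" "g \<noteq> h"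
      then show "g \<inter> h = {}"
        using cross[of g h] cross[of h g] disjointD[OF Q(2)] disjointD[OF N(1)]
        by (metis Int_commute UnE)
    qed
    moreover have "\<Q> \<inter> ?N = {}"
    proof (rule ccontr)
      assume "\<Q> \<inter> ?N \<noteq> {}"
      then obtain g where "g \<in> \<Q>" "g \<in> ?N" by blast
      then show False using cross[of g g] new(2)[of g] by simp
    qed
    then have "card (\<Q> \<union> ?N) = m + m div 2"
      using card_Un_disjoint[of \<Q> ?N] Q(1,3) N(2) 3 by simp
    moreover have "\<exists>p q. g = {p, q} \<and> (p \<in> X \<and> q \<in> Y \<or> p \<in> X \<and> q \<in> Z \<or> p \<in> Y \<and> q \<in> Z)"
      if "g \<in> \<Q> \<union> ?N" for g
      using that
    proof
      assume "g \<in> \<Q>"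
      then show ?thesis using Q(4)[of g] x(2) y(2) z(2) by blast
    next
      assume "g \<in> ?N"
      then consider "g = {x1, y1}" | "g = {x2, z1}" | "g = {y2, z2}" by blast
      then show ?thesis using x(2) y(2) z(2) by cases blast+
    qed
    moreover have "finite (\<Q> \<union> ?N)" using Q(1) by simp
    ultimately show ?thesis by blast
  qed
qed

text \<open>Disjoint groups of disjoint nonempty pieces have disjoint nonempty unions, so counting
  the unions counts the groups.\<close>

lemma disjoint_Union_groups:
  assumes "disjoint \<D>" "{} \<notin> \<D>" "disjoint \<G>" "\<And>g. g \<in> \<G> \<Longrightarrow> g \<subseteq> \<D> \<and> g \<noteq> {}"
  shows "disjoint (Union ` \<G>)" "inj_on Union \<G>"
proof -
  have disj: "\<Union>g \<inter> \<Union>h = {}" if "g \<in> \<G>" "h \<in> \<G>" "g \<noteq> h" for g h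
  proof -
    have gh: "g \<inter> h = {}" using assms(3) that by (auto dest: disjointD)
    have "D \<inter> D' = {}" if "D \<in> g" "D' \<in> h" for D D'
      using disjointD[OF assms(1), of D D'] that assms(4) \<open>g \<in> \<G>\<close> \<open>h \<in> \<G>\<close> gh by blast
    then show ?thesis by blast
  qed
  have ne: "\<Union>g \<noteq> {}" if g: "g \<in> \<G>" for g
  proof -
    obtain D where "D \<in> g" using assms(4)[OF g] by blast
    moreover from this have "D \<noteq> {}" using assms(2) assms(4)[OF g] by blast
    ultimately show ?thesis by blast
  qed
  show "disjoint (Union ` \<G>)" using disj by (auto intro!: disjointI)
  show "inj_on Union \<G>" by (rule inj_onI) (metis disj ne Int_absorb)
qed

lemma highly_connected_vertex_connectivity:
  assumes G: "pair_graph G" shows "highly_connected (vertex_connectivity G) G"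
  unfolding highly_connected_def
proof (intro allI impI)
  fix X assume "X \<subseteq> pverts G" "card X < vertex_connectivity G"
  with vertex_connectivity_le[OF G, of X]
  show "connected_in (parcs G) (pverts G - X) \<and> 2 \<le> card (pverts G - X)" by force
qed

theorem gen_connectivity_ge_vertex_connectivity:
  assumes G: "pair_graph G" and conn: "Digraph_Component.connected (with_proj G)"
    and "3 \<le> card (pverts G)"
  shows "(3 * vertex_connectivity G + 1) div 4 \<le> gen_connectivity 3 G"
proof (rule gen_connectivity_ge[OF G conn assms(3)])
  fix S assume SV: "S \<subseteq> pverts G" and "card S = 3"
  then obtain a b c where S: "S = {a, b, c}" "a \<noteq> b" "a \<noteq> c" "b \<noteq> c" by (metis card_3_iff)
  define k where "k = vertex_connectivity G"
  let ?E = "blowup G S k"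
  note hk = highly_connected_vertex_connectivity[OF G, folded k_def]
  have S': "S = {b, a, c}" "S = {c, a, b}" using S(1) by auto
  have "\<exists>\<D>. link_system ?E (copies k a) (copies k b) (copies k c) \<D>"
  proof (rule link_system_exists[OF finite_blowup[OF G] sym_blowup])
    show "linked ?E (copies k a) (copies k b \<union> copies k c)"
      using linked_blowup[OF G hk S(1-3) SV] .
    show "linked ?E (copies k b) (copies k a \<union> copies k c)"
      using linked_blowup[OF G hk S'(1) S(2)[symmetric] S(4) SV] .
    show "linked ?E (copies k c) (copies k a \<union> copies k b)"
      using linked_blowup[OF G hk S'(2) S(3)[symmetric] S(4)[symmetric] SV] .
  qed (simp_all add: copies_def)
  then obtain \<D> where sys: "link_system ?E (copies k a) (copies k b) (copies k c) \<D>" by blast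
  have disj: "disjoint \<D>" and piece: "\<And>D. D \<in> \<D> \<Longrightarrow> link_piece ?E (copies k a) (copies k b) (copies k c) D"
    and cover: "copies k a \<subseteq> \<Union>\<D>" "copies k b \<subseteq> \<Union>\<D>" "copies k c \<subseteq> \<Union>\<D>"
    using sys by (auto simp: link_system_def)
  define meets where "meets s D \<longleftrightarrow> D \<inter> copies k s \<noteq> {}" for s and D :: "'a node set"
  have meetsD: "\<exists>i. Copy s i \<in> D" if "meets s D" for s D using that by (auto simp: meets_def copies_def)
  have conn: "connected_in ?E D" if "D \<in> \<D>" for D using piece[OF that] by (simp add: link_piece_def)
  \<comment> \<open>Each of the \<open>k\<close> copies of a terminal lies in a piece of its
    own.\<close>
  have count: "finite {D \<in> \<D>. meets s D} \<and> card {D \<in> \<D>. meets s D} = k" if "s \<in> S" for s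
  proof -
    have c: "card (copies k s) = k" "finite (copies k s)"
      by (simp_all add: copies_def card_image inj_on_def)
    have one: "at_most_one (D \<inter> copies k s)" if "D \<in> \<D>" for D
      using piece[OF that] \<open>s \<in> S\<close> S(1) by (auto simp: link_piece_def)
    have "copies k s \<subseteq> \<Union>\<D>" using cover that S(1) by auto
    from card_pieces_meeting[OF disj this one c(2)] c(1) show ?thesis by (simp add: meets_def)
  qed
  define \<T> where "\<T> = {D \<in> \<D>. meets a D \<and> meets b D \<and> meets c D}"
  define AB where "AB = {D \<in> \<D>. meets a D \<and> meets b D \<and> \<not> meets c D}"
  define AC where "AC = {D \<in> \<D>. meets a D \<and> \<not> meets b D \<and> meets c D}"
  define BC where "BC = {D \<in> \<D>. \<not> meets a D \<and> meets b D \<and> meets c D}"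
  note defs = \<T>_def AB_def AC_def BC_def
  have two: "meets a D \<and> meets b D \<or> meets a D \<and> meets c D \<or> meets b D \<and> meets c D" if "D \<in> \<D>" for D
    using piece[OF that] by (auto simp: link_piece_def meets_def)
  have un: "{D \<in> \<D>. meets a D} = \<T> \<union> AB \<union> AC" "{D \<in> \<D>. meets b D} = \<T> \<union> AB \<union> BC"
    "{D \<in> \<D>. meets c D} = \<T> \<union> AC \<union> BC"
    using two unfolding defs by blast+
  have fin: "finite \<T>" "finite AB" "finite AC" "finite BC"
    using count[of a] count[of b] S(1) un by auto
  have dj: "\<T> \<inter> AB = {}" "\<T> \<inter> AC = {}" "\<T> \<inter> BC = {}" "AB \<inter> AC = {}" "AB \<inter> BC = {}" "AC \<inter> BC = {}"
    unfolding defs by blast+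
  \<comment> \<open>Comparing these equations shows that \<open>AB\<close>, \<open>AC\<close> and
    \<open>BC\<close> have equal size, as the pairing requires.\<close>
  have sums: "card \<T> + card AB + card AC = k" "card \<T> + card AB + card BC = k" "card \<T> + card AC + card BC = k"
    using count[of a] count[of b] count[of c] S(1) fin dj unfolding un
    by (auto simp: card_Un_disjoint Int_Un_distrib2)
  obtain \<Q> where Q: "finite \<Q>" "disjoint \<Q>" "card \<Q> = card AB + card AB div 2"
    "\<And>g. g \<in> \<Q> \<Longrightarrow> \<exists>p q. g = {p, q} \<and> (p \<in> AB \<and> q \<in> AC \<or> p \<in> AB \<and> q \<in> BC \<or> p \<in> AC \<and> q \<in> BC)"
    using pairing_three_classes[OF fin(2-4) refl _ _ dj(4-6)] sums by auto
  \<comment> \<open>Groups of pieces, each of which will be merged into one tree.\<close>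
  define \<G> where "\<G> = (\<lambda>D. {D}) ` \<T> \<union> \<Q>"
  have QT: "g \<subseteq> \<D>" "g \<inter> \<T> = {}" "g \<noteq> {}" if "g \<in> \<Q>" for g
    using Q(4)[OF that] dj unfolding defs by auto
  have card_G: "card \<G> = card \<T> + card \<Q>"
  proof -
    have "(\<lambda>D. {D}) ` \<T> \<inter> \<Q> = {}" using QT(2) by blast
    then show ?thesis
      unfolding \<G>_def using fin(1) Q(1) by (simp add: card_Un_disjoint card_image)
  qed
  have "disjoint \<G>"
  proof (rule disjointI)
    fix g h assume "g \<in> \<G>" "h \<in> \<G>" "g \<noteq> h"
    then show "g \<inter> h = {}" using QT(2) disjointD[OF Q(2)] unfolding \<G>_def by blast
  qed
  moreover have "g \<subseteq> \<D> \<and> g \<noteq> {}" if "g \<in> \<G>" for g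
    using that QT unfolding \<G>_def defs by blast
  moreover have "{} \<notin> \<D>" using two unfolding meets_def by blast
  ultimately have U: "disjoint (Union ` \<G>)" "inj_on Union \<G>"
    using disjoint_Union_groups[OF disj, of \<G>] by auto
  have join: "\<exists>F\<subseteq>shadow_arcs G S (D \<union> D'). \<lparr>pverts = shadow_verts G S (D \<union> D'), parcs = F\<rparr> \<in> S_trees G S"
    if D: "D \<in> \<D>" "D' \<in> \<D>" and meets: "meets s D" "meets s D'" "meets t D" "meets t' D'"
      and S3: "S = {s, t, t'}" for D D' s t t'
  proof -
    obtain i i' j j' where "Copy s i \<in> D" "Copy s i' \<in> D'" "Copy t j \<in> D" "Copy t' j' \<in> D'"
      using meets[THEN meetsD] by blast
    then show ?thesis by (rule shadow_tree[OF G S3 SV D[THEN conn]])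
  qed
  have "\<exists>F\<subseteq>shadow_arcs G S U. \<lparr>pverts = shadow_verts G S U, parcs = F\<rparr> \<in> S_trees G S"
    if U: "U \<in> Union ` \<G>" for U
  proof -
    obtain g where g: "U = \<Union>g" "g \<in> \<G>" using U by blast
    consider D where "g = {D}" "D \<in> \<T>" | "g \<in> \<Q>" using g(2) unfolding \<G>_def by blast
    then show ?thesis
    proof cases
      case (1 D)
      then show ?thesis using join[of D D a b c] S(1) g(1) unfolding defs by simp
    next
      case 2
      then obtain p q where pq: "g = {p, q}"
        and "p \<in> AB \<and> q \<in> AC \<or> p \<in> AB \<and> q \<in> BC \<or> p \<in> AC \<and> q \<in> BC" using Q(4) by blast
      \<comment> \<open>Two pieces of different types share exactly one terminal, which takes the
        place of \<open>s\<close> in \<open>join\<close>.\<close>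
      then have "\<exists>F\<subseteq>shadow_arcs G S (p \<union> q). \<lparr>pverts = shadow_verts G S (p \<union> q), parcs = F\<rparr> \<in> S_trees G S"
        using join[of p q a b c] join[of p q b a c] join[of p q c a b] S(1) S' unfolding defs by blast
      then show ?thesis using g(1) pq by simp
    qed
  qed
  then have "card (Union ` \<G>) \<le> tree_connectivity G S"
    using tree_connectivity_ge_disjoint_unions[OF G SV _ U(1)] \<open>card S = 3\<close> by simp
  then have "card \<T> + (card AB + card AB div 2) \<le> tree_connectivity G S"
    using card_image[OF U(2)] card_G Q(3) by simp
  moreover have "(3 * k + 1) div 4 \<le> card \<T> + (card AB + card AB div 2)"
  proof -
    define h where "h = card AB div 2"
    have "card AB \<le> 2 * h + 1" unfolding h_def by simp
    \<comment> \<open>Since \<open>k = card \<T> + 2 * card AB\<close>, this amounts to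
      \<open>2 * card AB < card \<T> + 4 * h + 3\<close>.\<close>
    then have "3 * k + 1 < (card \<T> + (card AB + h) + 1) * 4" using sums by simp
    then have "(3 * k + 1) div 4 < card \<T> + (card AB + h) + 1" by (rule less_mult_imp_div_less)
    then show ?thesis by (simp add: h_def)
  qed
  ultimately show "(3 * vertex_connectivity G + 1) div 4 \<le> tree_connectivity G S"
    unfolding k_def by linarith
qed

section \<open>The bound for the product and its sharpness\<close>

lemma gen_connectivity_pos:
  assumes G: "pair_graph G" and conn: "Digraph_Component.connected (with_proj G)"
    and k: "k \<le> card (pverts G)"
  shows "1 \<le> gen_connectivity k G"
proof (rule gen_connectivity_ge[OF G conn k])
  fix S assume S: "S \<subseteq> pverts G"
  note E = pair_graphD[OF G]
  \<comment> \<open>A single spanning tree of \<open>G\<close> is an \<open>S\<close>-tree for every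
    \<open>S\<close>.\<close>
  obtain F where F: "F \<subseteq> parcs G" "undirected_tree \<lparr>pverts = pverts G, parcs = F\<rparr>"
    using spanning_tree_exists[OF E(1) _ E(3,4)] conn connected_pair_graph_iff[OF G] by blast
  let ?T = "\<lparr>pverts = pverts G, parcs = F\<rparr>"
  have "pair_wf_digraph G" "pair_wf_digraph ?T" using E(3) F(1) by (auto simp: pair_wf_digraph_def)
  then have "?T \<in> S_trees G S"
    using F S by (auto simp: S_trees_def subgraph_def wf_digraph_wp_iff)
  then show "1 \<le> tree_connectivity G S"
    using tree_connectivity_ge[OF G, of "{?T}" S] by (simp add: pairwise_def)
qed

text \<open>Both sides are compared with
  \<open>vertex_connectivity G * card (pverts H)\<close>.\<close>

lemma lex_product_upper_bound:
  fixes G :: "'a pair_pre_digraph" and H :: "'b pair_pre_digraph"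
  assumes G: "pair_graph G" and conn: "Digraph_Component.connected (with_proj G)"
    and H: "pair_graph H" and connH: "Digraph_Component.connected (with_proj H)"
    and nc: "\<not> complete_graph G" and card: "2 \<le> card (pverts G)"
    and r: "r \<in> {0, 1, 2, 3}" "[r = vertex_connectivity G] (mod 4)"
  shows "int (gen_connectivity 3 (lex_product G H))
     \<le> \<lfloor>4 / 3 * real (gen_connectivity 3 G) + real r - 4 / 3 * real_of_int \<lceil>real r / 2\<rceil>\<rfloor>
         * int (card (pverts H))"
proof -
  let ?k = "vertex_connectivity G"
  let ?f = "4 / 3 * real (gen_connectivity 3 G) + real r - 4 / 3 * real_of_int \<lceil>real r / 2\<rceil>"
  \<comment> \<open>A connected graph on two vertices is complete.\<close>
  have "3 \<le> card (pverts G)"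
  proof (rule ccontr)
    assume "\<not> ?thesis"
    then have "card (pverts G) = 2" using card by simp
    then obtain u v where uv: "pverts G = {u, v}" "u \<noteq> v" by (auto simp: card_2_iff)
    note E = pair_graphD[OF G]
    have "(u, v) \<in> (parcs G \<inter> pverts G \<times> pverts G)\<^sup>*"
      using conn uv(1) connected_pair_graph_iff[OF G] by (auto simp: connected_in_def)
    then have "parcs G \<noteq> {}" using uv(2) by auto
    then obtain x y where xy: "(x, y) \<in> parcs G" by auto
    moreover have "x \<in> {u, v}" "y \<in> {u, v}" "x \<noteq> y" using xy E(3,5) uv(1) by auto
    ultimately have "(u, v) \<in> parcs G \<or> (v, u) \<in> parcs G" by auto
    then have "(u, v) \<in> parcs G" "(v, u) \<in> parcs G" using E(4) by (auto dest: symD)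
    then have "parcs G = {(x, y). (x, y) \<in> pverts G \<times> pverts G \<and> x \<noteq> y}" using E(3,5) uv by auto
    then show False using nc E(1) by (simp add: complete_graph_def complete_digraph_pair_def)
  qed
  then have low: "(3 * ?k + 1) div 4 \<le> gen_connectivity 3 G"
    by (rule gen_connectivity_ge_vertex_connectivity[OF G conn])
  obtain q where q: "?k = 4 * q + r"
  proof
    have "r = ?k mod 4" using r by (auto simp: cong_def)
    then show "?k = 4 * (?k div 4) + r" by simp
  qed
  have "real ?k \<le> ?f"
  proof -
    have "3 * ?k + 1 = (3 * r + 1) + 3 * q * 4" using q by simp
    then have "(3 * ?k + 1) div 4 = 3 * q + (3 * r + 1) div 4" by (metis div_mult_self1 zero_neq_numeral)
    then have "real (3 * q + (3 * r + 1) div 4) \<le> real (gen_connectivity 3 G)"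
      using low by (intro of_nat_mono) simp
    \<comment> \<open>For \<open>r\<close> = 0, 1, 2, 3 both sides are 0, 1, 1, 2. The subtracted
      ceiling thus cancels the remainder term, leaving \<open>?f\<close> at least
      \<open>4 * q + r\<close>.\<close>
    moreover have "\<lceil>real r / 2\<rceil> = int ((3 * r + 1) div 4)"
      using r(1) by (auto simp: ceiling_unique)
    ultimately show ?thesis using q by simp
  qed
  then have "int ?k \<le> \<lfloor>?f\<rfloor>" by (simp add: le_floor_iff)
  moreover have "gen_connectivity 3 (lex_product G H) \<le> ?k * card (pverts H)"
    using gen_connectivity_lex_product_le[OF G conn nc H] connH connected_pair_graph_iff[OF H] by blast
  then have "int (gen_connectivity 3 (lex_product G H)) \<le> int ?k * int (card (pverts H))"
    by (metis of_nat_le_iff of_nat_mult)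
  ultimately show ?thesis by (meson mult_right_mono of_nat_0_le_iff order_trans)
qed

text \<open>The middle vertex 1 is a minimum cut, the end vertex 0 of degree 1 limits the tree
  connectivity of \<open>G\<close>, and the product is a copy of the path. Spanning trees give the
  lower bounds.\<close>

lemma lex_product_bound_attained:
  defines "G \<equiv> \<lparr>pverts = {0, 1, 2}, parcs = {(0, 1), (1, 0), (1, 2), (2, 1)}\<rparr> :: nat pair_pre_digraph"
    and "H \<equiv> \<lparr>pverts = {0}, parcs = {}\<rparr> :: nat pair_pre_digraph"
  shows "pair_graph G" "Digraph_Component.connected (with_proj G)"
    "pair_graph H" "Digraph_Component.connected (with_proj H)"
    "2 \<le> card (pverts G)" "\<not> complete_graph G" "vertex_connectivity G = 1"
    "gen_connectivity 3 G = 1" "gen_connectivity 3 (lex_product G H) = 1"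
proof -
  show G: "pair_graph G" unfolding G_def by (rule pair_graphI) (auto simp: sym_def)
  show H: "pair_graph H" unfolding H_def by (rule pair_graphI) (auto simp: sym_def)
  have "connected_in (parcs G) (pverts G)"
    by (rule connected_in_root[OF pair_graphD(4)[OF G], of _ 1]) (auto simp: G_def)
  then show conn: "Digraph_Component.connected (with_proj G)"
    using connected_pair_graph_iff[OF G] by (simp add: G_def)
  show "Digraph_Component.connected (with_proj H)"
    using connected_pair_graph_iff[OF H] by (simp add: H_def connected_in_def)
  show card: "2 \<le> card (pverts G)" by (simp add: G_def)
  have "(0, 2) \<notin> parcs G" "(0, 2) \<in> pverts G \<times> pverts G" by (auto simp: G_def)
  then show nc: "\<not> complete_graph G" by (auto simp: complete_graph_def complete_digraph_pair_def)
  have "vertex_connectivity G \<le> card {1 :: nat}"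
  proof (rule vertex_connectivity_le[OF G])
    have "parcs G \<inter> (pverts G - {1}) \<times> (pverts G - {1}) = {}" by (auto simp: G_def)
    then have "\<not> connected_in (parcs G) (pverts G - {1})"
      unfolding connected_in_def by (auto simp: G_def)
    then show "\<not> connected_in (parcs G) (pverts G - {1}) \<or> card (pverts G - {1}) \<le> 1" ..
  qed (simp add: G_def)
  moreover have "vertex_connectivity G \<noteq> 0"
  proof
    assume "vertex_connectivity G = 0"
    moreover have "pverts G \<noteq> {}" by (simp add: G_def)
    ultimately obtain X u v where "X \<subseteq> pverts G" "card X = 0"
      "u \<in> pverts G - X" "v \<in> pverts G - X" "(u, v) \<notin> (parcs G \<inter> (pverts G - X) \<times> (pverts G - X))\<^sup>*"
      using minimum_cut_exists[OF G _ nc] by metis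
    moreover from this(1,2) have "X = {}" using pair_graphD(1)[OF G] by (auto dest: finite_subset)
    ultimately show False using conn connected_pair_graph_iff[OF G] by (auto simp: connected_in_def)
  qed
  ultimately show vc: "vertex_connectivity G = 1" by simp
  have "tree_connectivity G (pverts G) \<le> card {w. (0, w) \<in> parcs G}"
    by (rule tree_connectivity_le_degree[OF G, of _ _ 1]) (auto simp: G_def)
  also have "{w. (0, w) \<in> parcs G} = {1}" by (auto simp: G_def)
  finally have "gen_connectivity 3 G \<le> 1"
    using gen_connectivity_le[OF G, of "pverts G" 3] by (simp add: G_def)
  moreover have "1 \<le> gen_connectivity 3 G"
    by (rule gen_connectivity_pos[OF G conn]) (simp add: G_def)
  ultimately show "gen_connectivity 3 G = 1" by simp
  let ?P = "lex_product G H"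
  have P: "pair_graph ?P" by (rule pair_graph_lex_product[OF G H])
  have "connected_in (parcs ?P) (pverts ?P)"
    by (rule connected_in_root[OF pair_graphD(4)[OF P], of _ "(1, 0)"])
      (auto simp: lex_product_def G_def H_def)
  then have "Digraph_Component.connected (with_proj ?P)"
    using connected_pair_graph_iff[OF P] by (simp add: lex_product_def G_def H_def)
  then have "1 \<le> gen_connectivity 3 ?P"
    by (rule gen_connectivity_pos[OF P]) (simp add: lex_product_def G_def H_def card_cartesian_product)
  moreover have "gen_connectivity 3 ?P \<le> 1"
    using gen_connectivity_lex_product_le[OF G conn nc H] vc by (simp add: H_def)
  ultimately show "gen_connectivity 3 ?P = 1" by simp
qed

theorem theorem1p10:
  shows "(\<forall>(G :: 'a pair_pre_digraph) (H :: 'b pair_pre_digraph) (r :: nat).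
            pair_graph G \<and> Digraph_Component.connected (with_proj G) \<and>
            pair_graph H \<and> Digraph_Component.connected (with_proj H) \<and>
            2 \<le> card (pverts G) \<and> \<not> complete_graph G \<and>
            r \<in> {0, 1, 2, 3} \<and> [r = vertex_connectivity G] (mod 4) \<longrightarrow>
            int (gen_connectivity 3 (lex_product G H))
              \<le> \<lfloor>4 / 3 * real (gen_connectivity 3 G) + real r - 4 / 3 * real_of_int \<lceil>real r / 2\<rceil>\<rfloor>
                  * int (card (pverts H)))
       \<and> (\<exists>(G :: nat pair_pre_digraph) (H :: nat pair_pre_digraph) (r :: nat).
            pair_graph G \<and> Digraph_Component.connected (with_proj G) \<and>
            pair_graph H \<and> Digraph_Component.connected (with_proj H) \<and>
            2 \<le> card (pverts G) \<and> \<not> complete_graph G \<and>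
            r \<in> {0, 1, 2, 3} \<and> [r = vertex_connectivity G] (mod 4) \<and>
            int (gen_connectivity 3 (lex_product G H))
              = \<lfloor>4 / 3 * real (gen_connectivity 3 G) + real r - 4 / 3 * real_of_int \<lceil>real r / 2\<rceil>\<rfloor>
                  * int (card (pverts H)))"
proof (intro conjI)
  show "\<forall>(G :: 'a pair_pre_digraph) (H :: 'b pair_pre_digraph) (r :: nat).
            pair_graph G \<and> Digraph_Component.connected (with_proj G) \<and>
            pair_graph H \<and> Digraph_Component.connected (with_proj H) \<and>
            2 \<le> card (pverts G) \<and> \<not> complete_graph G \<and>
            r \<in> {0, 1, 2, 3} \<and> [r = vertex_connectivity G] (mod 4) \<longrightarrow>
            int (gen_connectivity 3 (lex_product G H))
              \<le> \<lfloor>4 / 3 * real (gen_connectivity 3 G) + real r - 4 / 3 * real_of_int \<lceil>real r / 2\<rceil>\<rfloor>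
                  * int (card (pverts H))"
    using lex_product_upper_bound by blast
next
  \<comment> \<open>With \<open>r = 1\<close> the bound evaluates to
    \<open>4/3 + 1 - 4/3 = 1\<close>.\<close>
  have "\<lceil>1 / 2 :: real\<rceil> = 1" by (rule ceiling_unique) auto
  then show "\<exists>(G :: nat pair_pre_digraph) (H :: nat pair_pre_digraph) (r :: nat).
            pair_graph G \<and> Digraph_Component.connected (with_proj G) \<and>
            pair_graph H \<and> Digraph_Component.connected (with_proj H) \<and>
            2 \<le> card (pverts G) \<and> \<not> complete_graph G \<and>
            r \<in> {0, 1, 2, 3} \<and> [r = vertex_connectivity G] (mod 4) \<and>
            int (gen_connectivity 3 (lex_product G H))
              = \<lfloor>4 / 3 * real (gen_connectivity 3 G) + real r - 4 / 3 * real_of_int \<lceil>real r / 2\<rceil>\<rfloor>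
                  * int (card (pverts H))"
    using lex_product_bound_attained
    by (intro exI[of _ "\<lparr>pverts = {0, 1, 2}, parcs = {(0, 1), (1, 0), (1, 2), (2, 1)}\<rparr>"]
        exI[of _ "\<lparr>pverts = {0}, parcs = {}\<rparr>"] exI[of _ 1]) simp
qed

end
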